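(* For a (complex) Banach space $X$ and $1\leq p\le 2$ the following statements are equivalent: (a) $X$ has type $p$; (b) there exists $C>0$ such that for every $m\in\mathbb{N}$ and every finite family $(x_\alpha)_{|\alpha|\le m}$ in $X$ (indexed by multi-indices $\alpha\in\mathbb{N}_0^n$ with $|\alpha|\le m$, for any number $n$ of variables) \[ \Big(\int_{\mathbb{T}^n}\Big\|\sum_{|\alpha|\le m}x_\alpha z^\alpha\Big\|^p dz\Big)^{1/p}\leq C^m\Big(\sum_{|\alpha|\le m}\|x_\alpha\|^p\Big)^{1/p}; \] (c) there exists $C>0$ such that for every $m\in\mathbb{N}$ and every finite family $\{x_A:|A|\le m\}\subset X$ (indexed by finite sets $A\subset\mathbb{N}$ with $|A|\le m$) we have \[ \Big(\mathbb{E}\Big\|\sum_A x_A\varepsilon_A\Big\|^p\Big)^{1/p}\leq C^m\Big(\sum_A\|x_A\|^p\Big)^{1/p}. \]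
   Context: $X$ has type $p$ ($1\le p\le2$) if there is a constant $C\geq1$ such that for every $N\in\mathbb{N}$ and all $x_1,\dots,x_N\in X$ \[ \Big(\int_{\mathbb{T}^N}\Big\|\sum_{n=1}^Nx_nz_n\Big\|^pdz\Big)^{1/p}\leq C\Big(\sum_{n=1}^N\|x_n\|^p\Big)^{1/p}. \] $\mathbb{T}$ is the unit circle in $\mathbb{C}$ and $dz$ denotes the normalized (product) Lebesgue measure. For a multi-index $\alpha=(\alpha_1,\dots,\alpha_n)$ of nonnegative integers, $|\alpha|=\alpha_1+\cdots+\alpha_n$ and $z^\alpha=z_1^{\alpha_1}\cdots z_n^{\alpha_n}$. $\{-1,1\}^\infty$ carries the infinite product of the uniform probability $(\delta_1+\delta_{-1})/2$, $\mathbb{E}$ is the expectation in $\varepsilon=(\varepsilon_n)_n\in\{-1,1\}^\infty$, and $\varepsilon_A=\prod_{n\in A}\varepsilon_n$ for finite $A\subset\mathbb{N}$ ($\varepsilon_\varnothing=1$). *)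

theory Defs
  imports "HOL-Probability.Probability"
begin

text \<open>
  Complex Banach spaces: real Banach spaces whose scalar multiplication extends to one by
  complex numbers, homogeneous for the norm.
\<close>

class scaleC =
  fixes scaleC :: "complex \<Rightarrow> 'a \<Rightarrow> 'a" (infixr "*\<^sub>C" 75)

class complex_banach = banach + scaleC +
  assumes scaleR_scaleC: "r *\<^sub>R x = complex_of_real r *\<^sub>C x"
    and scaleC_add_right: "a *\<^sub>C (x + y) = a *\<^sub>C x + a *\<^sub>C y"
    and scaleC_add_left: "(a + b) *\<^sub>C x = a *\<^sub>C x + b *\<^sub>C x"
    and scaleC_scaleC: "a *\<^sub>C (b *\<^sub>C x) = (a * b) *\<^sub>C x"
    and scaleC_one: "1 *\<^sub>C x = x"
    and norm_scaleC: "norm (a *\<^sub>C x) = cmod a * norm x"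

instantiation complex :: complex_banach
begin

definition scaleC_complex :: "complex \<Rightarrow> complex \<Rightarrow> complex"
  where "scaleC_complex a x = a * x"

instance
  by standard (auto simp: scaleC_complex_def scaleR_conv_of_real algebra_simps norm_mult)

end

definition circle_measure :: "complex measure" where
  "circle_measure =
     distr (uniform_measure lborel {0..<2 * pi}) (restrict_space borel (sphere 0 1)) cis"

definition torus_measure :: "nat \<Rightarrow> (nat \<Rightarrow> complex) measure" where
  "torus_measure N = (\<Pi>\<^sub>M i\<in>{..<N}. circle_measure)"

definition sign_measure :: "(nat \<Rightarrow> real) measure" where
  "sign_measure = (\<Pi>\<^sub>M i\<in>UNIV. uniform_count_measure {-1, 1})"

definition has_type :: "'a::complex_banach itself \<Rightarrow> real \<Rightarrow> bool" where
  "has_type _ p \<longleftrightarrow>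
     (\<exists>C\<ge>1. \<forall>N. \<forall>x :: nat \<Rightarrow> 'a.
        (\<integral>z. norm (\<Sum>n<N. z n *\<^sub>C x n) powr p \<partial>torus_measure N) powr (1 / p)
          \<le> C * (\<Sum>n<N. norm (x n) powr p) powr (1 / p))"

text \<open>
  Multi-indices in \<open>n\<close> variables are extensional functions on \<open>{..<n}\<close>, so that each one is
  represented exactly once.
\<close>

definition multi_indices :: "nat \<Rightarrow> nat \<Rightarrow> (nat \<Rightarrow> nat) set" where
  "multi_indices n m = {\<alpha> \<in> {..<n} \<rightarrow>\<^sub>E UNIV. (\<Sum>i<n. \<alpha> i) \<le> m}"

end

theory Submission
  imports Defs
begin

text \<open>
  The idea for the passage from type \<open>p\<close> to the polynomial inequalities: consider the terms whose
  monomials involve exactly \<open>s + 1\<close> variables, and draw a random set \<open>S\<close> of variables, each variable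
  being selected independently with probability \<open>1 / (s + 1)\<close>. A given monomial meets \<open>S\<close> in exactly
  one variable with probability \<open>(1 - 1 / (s + 1)) ^ s \<ge> 1 / e\<close>, so by convexity it suffices to bound,
  for every \<open>S\<close>, the part of the polynomial made of these monomials. For every exponent \<open>k\<close> this part
  is a sum over \<open>i \<in> S\<close> of \<open>z i ^ k\<close> times a polynomial in the variables outside \<open>S\<close>; type \<open>p\<close> applies
  conditionally on the latter, and the coefficients have \<open>s\<close> variables and a degree smaller by \<open>k\<close>.
  Induction on \<open>s\<close> bounds each term with a constant to the power of its degree. No decoupling or
  homogeneous projection is needed, since the right-hand side is additive over groups of terms.

  Both the torus and the sign cube are instances of the same argument: a Steinhaus sum dominates a
  sign sum by the contraction principle, and conversely \<open>z ^ k\<close> is a symmetric random variable on the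
  circle, so type inequalities for signs carry over to it.
\<close>

subsection \<open>Convexity and measurability\<close>

text \<open>Jensen's inequality for \<open>t powr p\<close> with weights of total mass at most 1.
  After normalising by the mass \<open>W\<close>, homogeneity leaves a factor
  \<open>W powr (p - 1)\<close>, which is at most 1.\<close>

lemma powr_sum_le:
  fixes w t :: "'k \<Rightarrow> real"
  assumes p: "1 \<le> p" and "finite K" and w: "\<And>k. k \<in> K \<Longrightarrow> 0 \<le> w k"
    and t: "\<And>k. k \<in> K \<Longrightarrow> 0 \<le> t k" and w1: "(\<Sum>k\<in>K. w k) \<le> 1"
  shows "(\<Sum>k\<in>K. w k * t k) powr p \<le> (\<Sum>k\<in>K. w k * t k powr p)"
proof -
  \<comment> \<open>Indices with zero weight or zero value contribute nothing to either side; on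
    \<open>L\<close> convexity is applied at positive points with positive weights.\<close>
  define L where "L = {k\<in>K. 0 < w k \<and> 0 < t k}"
  define W where "W = sum w L"
  have fL: "finite L" and LK: "L \<subseteq> K" using \<open>finite K\<close> by (auto simp: L_def)
  have zero: "w k * t k = 0" "w k * t k powr p = 0" if "k \<in> K - L" for k
    using that w[of k] t[of k] by (auto simp: L_def)
  have e1: "(\<Sum>k\<in>K. w k * t k) = (\<Sum>k\<in>L. w k * t k)"
    using zero \<open>finite K\<close> LK by (intro sum.mono_neutral_right) auto
  have e2: "(\<Sum>k\<in>K. w k * t k powr p) = (\<Sum>k\<in>L. w k * t k powr p)"
    using zero \<open>finite K\<close> LK by (intro sum.mono_neutral_right) auto
  show ?thesis
  proof (cases "L = {}")
    case True
    then show ?thesis unfolding e1 e2 by simp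
  next
    case False
    have W0: "0 < W" unfolding W_def using False fL by (intro sum_pos) (auto simp: L_def)
    have "W \<le> sum w K" unfolding W_def using \<open>finite K\<close> LK w by (intro sum_mono2) auto
    then have W1: "W \<le> 1" using w1 by simp
    have *: "(\<Sum>k\<in>L. (w k / W) *\<^sub>R t k) powr p \<le> (\<Sum>k\<in>L. (w k / W) * t k powr p)"
      by (rule convex_on_sum[OF fL False powr_convex[OF p]])
         (use W0 in \<open>auto simp: L_def W_def simp flip: sum_divide_distrib\<close>)
    have nn: "0 \<le> (\<Sum>k\<in>L. w k * t k)" by (intro sum_nonneg) (auto simp: L_def)
    have eq: "(\<Sum>k\<in>L. (w k / W) *\<^sub>R t k) = (\<Sum>k\<in>L. w k * t k) / W"
      by (simp add: sum_divide_distrib)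
    have "(\<Sum>k\<in>L. w k * t k) powr p = W powr p * (\<Sum>k\<in>L. (w k / W) *\<^sub>R t k) powr p"
      unfolding eq using W0 nn by (simp add: powr_divide)
    also have "\<dots> \<le> W powr p * (\<Sum>k\<in>L. (w k / W) * t k powr p)"
      using * by (intro mult_left_mono) auto
    also have "\<dots> = W powr (p - 1) * (\<Sum>k\<in>L. w k * t k powr p)"
      using W0 by (simp add: powr_diff sum_distrib_left)
    also have "\<dots> \<le> 1 * (\<Sum>k\<in>L. w k * t k powr p)"
      using W0 W1 p by (intro mult_right_mono powr_le1 sum_nonneg) (auto simp: L_def)
    finally show ?thesis unfolding e1 e2 by simp
  qed
qed

text \<open>The triangle inequality reduces this to scalar Jensen. Later splittings of a polynomial
  are instances, with weights \<open>(1/2) ^ k\<close>, \<open>1 / 2 ^ m\<close> or Bernoulli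
  weights.\<close>

lemma norm_sum_powr_le:
  fixes v :: "'k \<Rightarrow> 'a::real_normed_vector"
  assumes "1 \<le> p" "finite K" "\<And>k. k \<in> K \<Longrightarrow> 0 \<le> w k" "(\<Sum>k\<in>K. w k) \<le> 1"
  shows "norm (\<Sum>k\<in>K. w k *\<^sub>R v k) powr p \<le> (\<Sum>k\<in>K. w k * norm (v k) powr p)"
proof -
  have "norm (\<Sum>k\<in>K. w k *\<^sub>R v k) \<le> (\<Sum>k\<in>K. w k * norm (v k))"
    using assms(3) by (intro sum_norm_le) simp
  then have "norm (\<Sum>k\<in>K. w k *\<^sub>R v k) powr p \<le> (\<Sum>k\<in>K. w k * norm (v k)) powr p"
    using assms(1) by (intro powr_mono2) auto
  also have "\<dots> \<le> (\<Sum>k\<in>K. w k * norm (v k) powr p)"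
    using assms by (intro powr_sum_le) auto
  finally show ?thesis .
qed

text \<open>The vector \<open>u + t *\<^sub>R v\<close> is a convex combination of
  \<open>u + v\<close> and \<open>u - v\<close>. This is the one-coordinate step of the contraction
  principle.\<close>

lemma norm_powr_average:
  fixes u v :: "'a::real_normed_vector"
  assumes "1 \<le> p" "\<bar>t\<bar> \<le> 1"
  shows "norm (u + t *\<^sub>R v) powr p
    \<le> (1 + t) / 2 * norm (u + v) powr p + (1 - t) / 2 * norm (u - v) powr p"
proof -
  have eq: "u + t *\<^sub>R v = ((1 + t) / 2) *\<^sub>R (u + v) + ((1 - t) / 2) *\<^sub>R (u - v)"
  proof -
    have "((1 + t) / 2) *\<^sub>R (u + v) + ((1 - t) / 2) *\<^sub>R (u - v)
        = ((1 + t) / 2 + (1 - t) / 2) *\<^sub>R u + ((1 + t) / 2 - (1 - t) / 2) *\<^sub>R v"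
      unfolding scaleR_add_right scaleR_diff_right scaleR_add_left scaleR_diff_left by simp
    also have "\<dots> = u + t *\<^sub>R v" by (simp add: field_simps)
    finally show ?thesis by simp
  qed
  have "norm (\<Sum>b\<in>UNIV. (if b then (1 + t) / 2 else (1 - t) / 2) *\<^sub>R (if b then u + v else u - v)) powr p
     \<le> (\<Sum>b\<in>UNIV. (if b then (1 + t) / 2 else (1 - t) / 2) * norm (if b then u + v else u - v) powr p)"
    using assms by (intro norm_sum_powr_le) (auto simp: UNIV_bool field_simps)
  then show ?thesis
    unfolding eq UNIV_bool by (simp add: add.commute)
qed

lemma norm_add_powr_le:
  fixes u v :: "'a::real_normed_vector"
  assumes "1 \<le> p"
  shows "norm (u + v) powr p \<le> 2 powr p * ((norm u powr p + norm v powr p) / 2)"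
proof -
  have "norm (u + v) powr p = 2 powr p * norm ((1/2) *\<^sub>R (u + v)) powr p"
    by (simp add: powr_divide)
  also have "norm ((1/2) *\<^sub>R (u + v)) powr p \<le> (norm u powr p + norm v powr p) / 2"
    using norm_sum_powr_le[OF assms(1), of "UNIV::bool set" "\<lambda>b. 1/2" "\<lambda>b. if b then u else v"]
    by (simp add: UNIV_bool algebra_simps)
  finally show ?thesis by simp
qed

text \<open>Both sides are nonnegative, so they may be compared after taking \<open>p\<close>-th
  powers. The main estimates are therefore proved without roots.\<close>

lemma powr_inverse_le_iff:
  fixes I B C p :: real
  assumes "0 \<le> I" "0 \<le> B" "0 \<le> C" "0 < p"
  shows "I powr (1 / p) \<le> C * B powr (1 / p) \<longleftrightarrow> I \<le> C powr p * B"
proof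
  assume *: "I powr (1 / p) \<le> C * B powr (1 / p)"
  have "I = (I powr (1 / p)) powr p" using assms by (simp add: powr_powr)
  also have "\<dots> \<le> (C * B powr (1 / p)) powr p" using * assms by (intro powr_mono2) auto
  also have "\<dots> = C powr p * B" using assms by (simp add: powr_mult powr_powr)
  finally show "I \<le> C powr p * B" .
next
  assume *: "I \<le> C powr p * B"
  have "I powr (1 / p) \<le> (C powr p * B) powr (1 / p)"
    using * assms by (intro powr_mono2) auto
  also have "\<dots> = C * B powr (1 / p)" using assms by (simp add: powr_mult powr_powr)
  finally show "I powr (1 / p) \<le> C * B powr (1 / p)" .
qed

section \<open>Complex scalars and measurability of vector-valued sums\<close>

lemma bounded_linear_scaleC_left: "bounded_linear (\<lambda>c. c *\<^sub>C (x::'a::complex_banach))"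
proof (rule bounded_linear_intro)
  show "(r *\<^sub>R c) *\<^sub>C x = r *\<^sub>R (c *\<^sub>C x)" for r c
    by (simp only: scaleR_scaleC scaleC_scaleC scaleC_complex_def)
  show "norm (c *\<^sub>C x) \<le> norm c * norm x" for c
    by (simp add: norm_scaleC)
qed (rule scaleC_add_left)

lemma bounded_linear_scaleC_right: "bounded_linear (\<lambda>x::'a::complex_banach. c *\<^sub>C x)"
proof (rule bounded_linear_intro)
  show "c *\<^sub>C (r *\<^sub>R x) = r *\<^sub>R (c *\<^sub>C x)" for r and x :: 'a
    by (simp add: scaleR_scaleC scaleC_scaleC mult.commute)
  show "norm (c *\<^sub>C x) \<le> norm x * norm c" for x :: 'a
    by (simp add: norm_scaleC)
qed (rule scaleC_add_right)

lemmas scaleC_sum_right = linear_sum[OF bounded_linear.linear[OF bounded_linear_scaleC_right]]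
lemmas scaleC_zero_right = linear_0[OF bounded_linear.linear[OF bounded_linear_scaleC_right]]
lemmas scaleC_minus_left = linear_neg[OF bounded_linear.linear[OF bounded_linear_scaleC_left]]

text \<open>Simple functions take finitely many values, so their sums stay simple whatever the size
  of the space.\<close>

lemma simple_function_sum_vector:
  fixes f :: "'k \<Rightarrow> 'w \<Rightarrow> 'a::comm_monoid_add"
  assumes "finite K" "\<And>k. k \<in> K \<Longrightarrow> simple_function N (f k)"
  shows "simple_function N (\<lambda>w. \<Sum>k\<in>K. f k w)"
  using assms
proof (induction K)
  case (insert k K)
  then show ?case
    by (simp add: simple_function_compose2[where h="(+)"])
qed simp

text \<open>
  The space \<open>'a\<close> may be non-separable, so Borel measurability of a sum does not follow from
  that of its terms; here it holds since the terms are limits of simple functions.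
\<close>
lemma borel_measurable_sum_scaleC:
  fixes x :: "'k \<Rightarrow> 'a::complex_banach"
  assumes K: "finite K" and c: "\<And>k. k \<in> K \<Longrightarrow> c k \<in> borel_measurable N"
  shows "(\<lambda>w. \<Sum>k\<in>K. c k w *\<^sub>C x k) \<in> borel_measurable N"
proof -
  have "\<forall>k\<in>K. \<exists>F. (\<forall>i. simple_function N (F i)) \<and> (\<forall>w\<in>space N. (\<lambda>i. F i w) \<longlonglongrightarrow> c k w)"
    using borel_measurable_implies_sequence_metric[OF c, where z = 0] by blast
  from bchoice[OF this] obtain F where F: "\<And>k i. k \<in> K \<Longrightarrow> simple_function N (F k i)"
      "\<And>k w. k \<in> K \<Longrightarrow> w \<in> space N \<Longrightarrow> (\<lambda>i. F k i w) \<longlonglongrightarrow> c k w"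
    by blast
  show ?thesis
  proof (rule borel_measurable_LIMSEQ_metric)
    fix i
    have "simple_function N (\<lambda>w. \<Sum>k\<in>K. F k i w *\<^sub>C x k)"
      by (rule simple_function_sum_vector[OF K])
         (rule simple_function_compose1[OF F(1), where g = "\<lambda>c. c *\<^sub>C x _"])
    then show "(\<lambda>w. \<Sum>k\<in>K. F k i w *\<^sub>C x k) \<in> borel_measurable N"
      by (rule borel_measurable_simple_function)
  next
    fix w assume "w \<in> space N"
    then show "(\<lambda>i. \<Sum>k\<in>K. F k i w *\<^sub>C x k) \<longlonglongrightarrow> (\<Sum>k\<in>K. c k w *\<^sub>C x k)"
      using F(2) by (intro tendsto_sum bounded_linear.tendsto[OF bounded_linear_scaleC_left]) auto
  qed
qed

lemma borel_measurable_norm_sum_scaleC: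
  fixes x :: "'k \<Rightarrow> 'a::complex_banach"
  assumes "finite K" "\<And>k. k \<in> K \<Longrightarrow> c k \<in> borel_measurable N"
  shows "(\<lambda>w. norm (\<Sum>k\<in>K. c k w *\<^sub>C x k) powr p) \<in> borel_measurable N"
  using borel_measurable_sum_scaleC[OF assms, where x = x] by measurable

lemma norm_sum_scaleC_powr_le:
  fixes x :: "'k \<Rightarrow> 'a::complex_banach"
  assumes "0 \<le> p" "\<And>k. k \<in> K \<Longrightarrow> cmod (c k) \<le> 1"
  shows "norm (\<Sum>k\<in>K. c k *\<^sub>C x k) powr p \<le> (\<Sum>k\<in>K. norm (x k)) powr p"
proof -
  have "norm (\<Sum>k\<in>K. c k *\<^sub>C x k) \<le> (\<Sum>k\<in>K. norm (x k))"
    by (rule sum_norm_le) (simp add: norm_scaleC assms mult_left_le_one_le)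
  then show ?thesis using assms by (intro powr_mono2) auto
qed

lemma integrable_norm_sum_scaleC:
  fixes x :: "'k \<Rightarrow> 'a::complex_banach"
  assumes N: "finite_measure N" and "0 \<le> p" "finite K"
    "\<And>k. k \<in> K \<Longrightarrow> c k \<in> borel_measurable N"
    "\<And>k w. k \<in> K \<Longrightarrow> w \<in> space N \<Longrightarrow> cmod (c k w) \<le> 1"
  shows "integrable N (\<lambda>w. norm (\<Sum>k\<in>K. c k w *\<^sub>C x k) powr p)"
  by (rule finite_measure.integrable_const_bound[OF N, where B = "(\<Sum>k\<in>K. norm (x k)) powr p"])
     (use assms in \<open>auto intro!: AE_I2 norm_sum_scaleC_powr_le borel_measurable_norm_sum_scaleC\<close>)

subsection \<open>Powers of a probability space\<close>

abbreviation pow_measure :: "'i set \<Rightarrow> 'w measure \<Rightarrow> ('i \<Rightarrow> 'w) measure" where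
  "pow_measure V M \<equiv> Pi\<^sub>M V (\<lambda>_. M)"

lemma product_prob_space_const: "prob_space M \<Longrightarrow> product_prob_space (\<lambda>_. M)"
  by (rule product_prob_spaceI)

lemma prob_space_pow_measure: "prob_space M \<Longrightarrow> prob_space (pow_measure V M)"
  by (rule prob_space_PiM)

text \<open>A product of measure-preserving maps preserves the product measure, as is checked on
  boxes. The maps may vary with the coordinate, so that later only selected variables are
  flipped.\<close>

lemma integral_pow_measure_coordinatewise:
  fixes h :: "('i \<Rightarrow> 'w) \<Rightarrow> real"
  assumes M: "prob_space M" and "finite V"
    and T: "\<And>i. i \<in> V \<Longrightarrow> T i \<in> M \<rightarrow>\<^sub>M M" "\<And>i. i \<in> V \<Longrightarrow> distr M M (T i) = M"
    and h: "h \<in> borel_measurable (pow_measure V M)"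
  shows "(\<integral>w. h (\<lambda>i\<in>V. T i (w i)) \<partial>pow_measure V M) = (\<integral>w. h w \<partial>pow_measure V M)"
proof -
  interpret product_prob_space "\<lambda>_. M" by (rule product_prob_space_const[OF M])
  have meas: "(\<lambda>w. \<lambda>i\<in>V. T i (w i)) \<in> pow_measure V M \<rightarrow>\<^sub>M pow_measure V M"
    using T(1) by (intro measurable_restrict measurable_compose[OF measurable_component_singleton]) auto
  have "distr (pow_measure V M) (pow_measure V M) (\<lambda>w. \<lambda>i\<in>V. T i (w i)) = pow_measure V M"
  proof (rule PiM_eqI[OF \<open>finite V\<close>])
    fix A assume A: "\<And>i. i \<in> V \<Longrightarrow> A i \<in> sets M"
    have B: "T i -` A i \<inter> space M \<in> sets M" if "i \<in> V" for i
      using T(1)[OF that] A[OF that] by (rule measurable_sets)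
    have "(\<lambda>w. \<lambda>i\<in>V. T i (w i)) -` (Pi\<^sub>E V A) \<inter> space (pow_measure V M)
        = Pi\<^sub>E V (\<lambda>i. T i -` A i \<inter> space M)"
      by (auto simp: space_PiM PiE_def Pi_def)
    then have "emeasure (distr (pow_measure V M) (pow_measure V M) (\<lambda>w. \<lambda>i\<in>V. T i (w i))) (Pi\<^sub>E V A)
        = emeasure (pow_measure V M) (Pi\<^sub>E V (\<lambda>i. T i -` A i \<inter> space M))"
      using meas A \<open>finite V\<close> by (subst emeasure_distr) auto
    also have "\<dots> = (\<Prod>i\<in>V. emeasure M (T i -` A i \<inter> space M))"
      using \<open>finite V\<close> B by (rule emeasure_PiM)
    also have "\<dots> = (\<Prod>i\<in>V. emeasure M (A i))"
    proof (rule prod.cong[OF refl])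
      fix i assume i: "i \<in> V"
      have "emeasure M (T i -` A i \<inter> space M) = emeasure (distr M M (T i)) (A i)"
        using T(1)[OF i] A[OF i] by (simp add: emeasure_distr)
      then show "emeasure M (T i -` A i \<inter> space M) = emeasure M (A i)" by (simp add: T(2)[OF i])
    qed
    finally show "emeasure (distr (pow_measure V M) (pow_measure V M) (\<lambda>w. \<lambda>i\<in>V. T i (w i))) (Pi\<^sub>E V A)
        = (\<Prod>i\<in>V. emeasure M (A i))" .
  qed simp
  then show ?thesis
    using integral_distr[OF meas h] by simp
qed

text \<open>
  This form of Fubini's theorem resamples the coordinates in \<open>S\<close>, which avoids integrals over
  sub-powers.
\<close>
lemma integral_pow_measure_split:
  fixes f :: "('i \<Rightarrow> 'w) \<Rightarrow> real"
  assumes M: "prob_space M" and "finite V" "S \<subseteq> V" and f: "integrable (pow_measure V M) f"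
  shows "(\<integral>w. f w \<partial>pow_measure V M)
    = (\<integral>w'. (\<integral>w. f (\<lambda>i\<in>V. if i \<in> S then w i else w' i) \<partial>pow_measure V M) \<partial>pow_measure V M)"
proof -
  interpret product_prob_space "\<lambda>_. M" by (rule product_prob_space_const[OF M])
  have V: "(V - S) \<union> S = V" using assms by auto
  have fin: "finite S" "finite (V - S)" using assms finite_subset by auto
  have f': "f \<in> borel_measurable (pow_measure (V - S \<union> S) M)" using f V by simp
  have meas: "(\<lambda>(x, y). f (merge (V - S) S (x, y)))
      \<in> borel_measurable (pow_measure (V - S) M \<Otimes>\<^sub>M pow_measure S M)"
    using measurable_compose[OF measurable_merge f'] by (simp add: case_prod_unfold)
  have r1: "(\<lambda>w. restrict w (V - S)) \<in> pow_measure V M \<rightarrow>\<^sub>M pow_measure (V - S) M"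
    and r2: "(\<lambda>w. restrict w S) \<in> pow_measure V M \<rightarrow>\<^sub>M pow_measure S M"
    using assms by (auto intro!: measurable_restrict_subset)
  \<comment> \<open>Each sub-power is the image of the full power under restriction, so both
    integrals of Fubini's theorem can be pulled back to \<open>V\<close>.\<close>
  have d1: "pow_measure (V - S) M = distr (pow_measure V M) (pow_measure (V - S) M) (\<lambda>w. restrict w (V - S))"
    and d2: "pow_measure S M = distr (pow_measure V M) (pow_measure S M) (\<lambda>w. restrict w S)"
    using assms by (auto intro!: distr_restrict)
  have mx: "(\<lambda>y. f (merge (V - S) S (x, y))) \<in> borel_measurable (pow_measure S M)"
    if "x \<in> space (pow_measure (V - S) M)" for x
    using measurable_compose[OF measurable_Pair1'[OF that] meas] by simp
  have mo: "(\<lambda>x. \<integral>y. f (merge (V - S) S (x, y)) \<partial>pow_measure S M)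
      \<in> borel_measurable (pow_measure (V - S) M)"
    using meas by (rule sigma_finite_measure.borel_measurable_lebesgue_integral
        [OF prob_space_imp_sigma_finite[OF prob_space_pow_measure[OF M]]])
  have mg: "merge (V - S) S (restrict w' (V - S), restrict w S)
      = (\<lambda>i\<in>V. if i \<in> S then w i else w' i)" for w w' :: "'i \<Rightarrow> 'w"
    using assms by (auto simp: merge_def fun_eq_iff)
  have "(\<integral>w. f w \<partial>pow_measure V M)
      = (\<integral>x. (\<integral>y. f (merge (V - S) S (x, y)) \<partial>pow_measure S M) \<partial>pow_measure (V - S) M)"
    using product_integral_fold[of "V - S" S f] fin f V by auto
  also have "\<dots> = (\<integral>w'. (\<integral>y. f (merge (V - S) S (restrict w' (V - S), y)) \<partial>pow_measure S M)
      \<partial>pow_measure V M)"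
    by (subst d1) (rule integral_distr[OF r1 mo])
  also have "\<dots> = (\<integral>w'. (\<integral>w. f (merge (V - S) S (restrict w' (V - S), restrict w S)) \<partial>pow_measure V M)
      \<partial>pow_measure V M)"
  proof (rule Bochner_Integration.integral_cong[OF refl])
    fix w' assume "w' \<in> space (pow_measure V M)"
    then have "restrict w' (V - S) \<in> space (pow_measure (V - S) M)"
      using r1 by (rule measurable_space[rotated])
    from integral_distr[OF r2 mx[OF this]]
    show "(\<integral>y. f (merge (V - S) S (restrict w' (V - S), y)) \<partial>pow_measure S M)
      = (\<integral>w. f (merge (V - S) S (restrict w' (V - S), restrict w S)) \<partial>pow_measure V M)"
      by (simp flip: d2)
  qed
  finally show ?thesis unfolding mg .
qed

text \<open>For fixed \<open>e\<close>, applying \<open>T\<close> exactly in the coordinates with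
  sign -1 preserves the product measure and produces the signs \<open>s i e\<close>. Averaging over
  \<open>E\<close> and Fubini's theorem give the identity.\<close>

lemma
  fixes x :: "'i \<Rightarrow> 'a::complex_banach" and s :: "'i \<Rightarrow> 'e \<Rightarrow> real"
  assumes p: "0 \<le> p" and E: "prob_space E" and M: "prob_space M" and V: "finite V"
    and s: "\<And>i. i \<in> V \<Longrightarrow> s i \<in> borel_measurable E"
      "\<And>i e. i \<in> V \<Longrightarrow> e \<in> space E \<Longrightarrow> s i e \<in> {-1, 1}"
    and \<psi>: "\<psi> \<in> borel_measurable M" "\<And>w. w \<in> space M \<Longrightarrow> cmod (\<psi> w) \<le> 1"
    and T: "T \<in> M \<rightarrow>\<^sub>M M" "distr M M T = M" "\<And>w. w \<in> space M \<Longrightarrow> \<psi> (T w) = - \<psi> w"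
  shows integral_symmetrization:
      "(\<integral>w. norm (\<Sum>i\<in>V. \<psi> (w i) *\<^sub>C x i) powr p \<partial>pow_measure V M)
        = (\<integral>w. (\<integral>e. norm (\<Sum>i\<in>V. s i e *\<^sub>R \<psi> (w i) *\<^sub>C x i) powr p \<partial>E) \<partial>pow_measure V M)"
    and integrable_symmetrization:
      "integrable (pow_measure V M)
         (\<lambda>w. \<integral>e. norm (\<Sum>i\<in>V. s i e *\<^sub>R \<psi> (w i) *\<^sub>C x i) powr p \<partial>E)"
proof -
  let ?P = "pow_measure V M"
  interpret E: prob_space E by fact
  interpret P: prob_space ?P by (rule prob_space_pow_measure[OF M])
  interpret PE: pair_prob_space ?P E ..
  define F where "F w e = norm (\<Sum>i\<in>V. s i e *\<^sub>R \<psi> (w i) *\<^sub>C x i) powr p" for w e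
  \<comment> \<open>Absorbing the sign into the complex coefficient gives the shape required by
    \<open>integrable_norm_sum_scaleC\<close>.\<close>
  have F: "F w e = norm (\<Sum>i\<in>V. (of_real (s i e) * \<psi> (w i)) *\<^sub>C x i) powr p" for w e
    by (simp add: F_def scaleR_scaleC scaleC_scaleC)
  have m1: "(\<lambda>w. \<psi> (w i)) \<in> borel_measurable ?P" if "i \<in> V" for i
    by (rule measurable_compose[where f = "\<lambda>w. w i", OF _ \<psi>(1)]) (use that in auto)
  have sp: "w i \<in> space M" if "w \<in> space ?P" "i \<in> V" for w i
    using that by (auto simp: space_PiM)
  have int: "integrable (?P \<Otimes>\<^sub>M E) (case_prod F)"
    unfolding F case_prod_unfold
  proof (rule integrable_norm_sum_scaleC)
    show "finite_measure (?P \<Otimes>\<^sub>M E)" by unfold_locales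
    fix i assume i: "i \<in> V"
    show "(\<lambda>we. complex_of_real (s i (snd we)) * \<psi> (fst we i)) \<in> borel_measurable (?P \<Otimes>\<^sub>M E)"
      using measurable_compose[OF measurable_fst m1[OF i]] measurable_compose[OF measurable_snd s(1)[OF i]]
      by measurable
    fix we assume "we \<in> space (?P \<Otimes>\<^sub>M E)"
    then show "cmod (complex_of_real (s i (snd we)) * \<psi> (fst we i)) \<le> 1"
      using s(2)[OF i, of "snd we"] \<psi>(2)[OF sp[OF _ i, of "fst we"]]
      by (auto simp: space_pair_measure norm_mult)
  qed (use p V in auto)
  have "(\<integral>w. F w e \<partial>?P) = (\<integral>w. norm (\<Sum>i\<in>V. \<psi> (w i) *\<^sub>C x i) powr p \<partial>?P)"
    if e: "e \<in> space E" for e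
  proof -
    let ?T = "\<lambda>i. if s i e = 1 then (\<lambda>w. w) else T"
    let ?h = "\<lambda>w. norm (\<Sum>i\<in>V. \<psi> (w i) *\<^sub>C x i) powr p"
    have "(\<integral>w. F w e \<partial>?P) = (\<integral>w. ?h (\<lambda>i\<in>V. ?T i (w i)) \<partial>?P)"
    proof (rule Bochner_Integration.integral_cong[OF refl])
      fix w assume w: "w \<in> space ?P"
      have "s i e *\<^sub>R \<psi> (w i) *\<^sub>C x i = \<psi> (?T i (w i)) *\<^sub>C x i" if "i \<in> V" for i
        using s(2)[OF that e] T(3)[OF sp[OF w that]] by (auto simp: scaleC_minus_left)
      then show "F w e = ?h (\<lambda>i\<in>V. ?T i (w i))"
        unfolding F_def by (auto intro!: arg_cong[where f = "\<lambda>v. norm v powr p"] sum.cong)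
    qed
    also have "\<dots> = (\<integral>w. ?h w \<partial>?P)"
    proof (rule integral_pow_measure_coordinatewise[OF M V])
      show "?h \<in> borel_measurable ?P"
        by (rule borel_measurable_norm_sum_scaleC[OF V m1])
      show "?T i \<in> M \<rightarrow>\<^sub>M M" for i using T(1) by simp
      show "distr M M (?T i) = M" for i using T(2) by (simp add: distr_id2)
    qed
    finally show ?thesis .
  qed
  then have "(\<integral>e. (\<integral>w. F w e \<partial>?P) \<partial>E) = (\<integral>e. (\<integral>w. norm (\<Sum>i\<in>V. \<psi> (w i) *\<^sub>C x i) powr p \<partial>?P) \<partial>E)"
    by (rule Bochner_Integration.integral_cong[OF refl])
  then have "(\<integral>w. norm (\<Sum>i\<in>V. \<psi> (w i) *\<^sub>C x i) powr p \<partial>?P) = (\<integral>w. (\<integral>e. F w e \<partial>E) \<partial>?P)"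
    using PE.Fubini_integral[OF int] by (simp add: E.prob_space)
  then show "(\<integral>w. norm (\<Sum>i\<in>V. \<psi> (w i) *\<^sub>C x i) powr p \<partial>?P)
      = (\<integral>w. (\<integral>e. norm (\<Sum>i\<in>V. s i e *\<^sub>R \<psi> (w i) *\<^sub>C x i) powr p \<partial>E) \<partial>?P)"
    unfolding F_def .
  show "integrable ?P (\<lambda>w. \<integral>e. norm (\<Sum>i\<in>V. s i e *\<^sub>R \<psi> (w i) *\<^sub>C x i) powr p \<partial>E)"
    using PE.integrable_fst[OF int] unfolding F_def .
qed

text \<open>After symmetrization, the sign inequality is applied for each fixed \<open>w\<close> to
  the vectors \<open>\<psi> (w i) *\<^sub>C x i\<close>, whose norms are at most those of
  \<open>x i\<close>.\<close>

lemma type_of_symmetric: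
  fixes x :: "'i \<Rightarrow> 'a::complex_banach" and s :: "'i \<Rightarrow> 'e \<Rightarrow> real"
  assumes p: "0 \<le> p" and E: "prob_space E" and M: "prob_space M" and V: "finite V"
    and s: "\<And>i. i \<in> V \<Longrightarrow> s i \<in> borel_measurable E"
      "\<And>i e. i \<in> V \<Longrightarrow> e \<in> space E \<Longrightarrow> s i e \<in> {-1, 1}"
    and \<psi>: "\<psi> \<in> borel_measurable M" "\<And>w. w \<in> space M \<Longrightarrow> cmod (\<psi> w) \<le> 1"
    and T: "T \<in> M \<rightarrow>\<^sub>M M" "distr M M T = M" "\<And>w. w \<in> space M \<Longrightarrow> \<psi> (T w) = - \<psi> w"
    and R: "0 \<le> R" "\<And>y :: 'i \<Rightarrow> 'a. (\<integral>e. norm (\<Sum>i\<in>V. s i e *\<^sub>R y i) powr p \<partial>E)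
      \<le> R * (\<Sum>i\<in>V. norm (y i) powr p)"
  shows "(\<integral>w. norm (\<Sum>i\<in>V. \<psi> (w i) *\<^sub>C x i) powr p \<partial>pow_measure V M)
    \<le> R * (\<Sum>i\<in>V. norm (x i) powr p)"
proof -
  let ?P = "pow_measure V M"
  interpret P: prob_space ?P by (rule prob_space_pow_measure[OF M])
  have "(\<integral>w. (\<integral>e. norm (\<Sum>i\<in>V. s i e *\<^sub>R \<psi> (w i) *\<^sub>C x i) powr p \<partial>E) \<partial>?P)
      \<le> (\<integral>w. R * (\<Sum>i\<in>V. norm (x i) powr p) \<partial>?P)"
  proof (rule integral_mono')
    fix w assume w: "w \<in> space ?P"
    have "norm (\<psi> (w i) *\<^sub>C x i) powr p \<le> norm (x i) powr p" if "i \<in> V" for i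
    proof -
      have "cmod (\<psi> (w i)) \<le> 1" using w that by (intro \<psi>(2)) (auto simp: space_PiM)
      then show ?thesis
        using p by (intro powr_mono2) (auto simp: norm_scaleC mult_left_le_one_le)
    qed
    then show "(\<integral>e. norm (\<Sum>i\<in>V. s i e *\<^sub>R \<psi> (w i) *\<^sub>C x i) powr p \<partial>E)
        \<le> R * (\<Sum>i\<in>V. norm (x i) powr p)"
      by (intro order_trans[OF R(2)] mult_left_mono sum_mono R(1)) auto
    show "0 \<le> R * (\<Sum>i\<in>V. norm (x i) powr p)"
      using R(1) by (intro mult_nonneg_nonneg sum_nonneg) auto
  qed simp
  then show ?thesis
    using integral_symmetrization[OF p E M V s \<psi> T, where x = x] by (simp add: P.prob_space)
qed

subsection \<open>Contraction principle for signs\<close>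

abbreviation sign_space :: "real measure" where
  "sign_space \<equiv> uniform_count_measure {-1, 1}"

lemma prob_space_sign_space: "prob_space sign_space"
  by (intro prob_space_uniform_count_measure) auto

lemma borel_measurable_sign_space: "(f :: real \<Rightarrow> 'b::topological_space) \<in> borel_measurable sign_space"
  by (simp add: measurable_def sets_uniform_count_measure space_uniform_count_measure)

lemma measurable_uminus_sign_space: "uminus \<in> sign_space \<rightarrow>\<^sub>M sign_space"
  by (auto simp: measurable_def sets_uniform_count_measure space_uniform_count_measure)

lemma distr_uminus_sign_space: "distr sign_space sign_space uminus = sign_space"
proof (rule measure_eqI)
  fix A assume "A \<in> sets (distr sign_space sign_space uminus)"
  then have A: "A \<subseteq> {-1, 1}" by (simp add: sets_uniform_count_measure)
  have "uminus -` A \<inter> {-1, 1} = uminus ` A" using A by (auto simp: image_iff)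
  moreover have "uminus ` A \<subseteq> {-1, 1}" using A by auto
  ultimately show "emeasure (distr sign_space sign_space uminus) A = emeasure sign_space A"
    using A measurable_uminus_sign_space
    by (subst emeasure_distr)
       (auto simp: sets_uniform_count_measure space_uniform_count_measure
         emeasure_uniform_count_measure card_image)
qed simp

lemma integrable_sign_sum:
  fixes y :: "'i \<Rightarrow> 'a::complex_banach"
  assumes "0 \<le> p" "finite V" "W \<subseteq> V" "\<And>i. i \<in> W \<Longrightarrow> \<bar>a i\<bar> \<le> 1"
  shows "integrable (pow_measure V sign_space) (\<lambda>e. norm (\<Sum>i\<in>W. (e i * a i) *\<^sub>R y i) powr p)"
proof -
  interpret prob_space "pow_measure V sign_space"
    by (rule prob_space_pow_measure[OF prob_space_sign_space])
  have "integrable (pow_measure V sign_space)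
     (\<lambda>e. norm (\<Sum>i\<in>W. complex_of_real (e i * a i) *\<^sub>C y i) powr p)"
  proof (rule integrable_norm_sum_scaleC)
    show "finite W" using assms finite_subset by auto
    fix i assume i: "i \<in> W"
    then show "(\<lambda>e. complex_of_real (e i * a i)) \<in> borel_measurable (pow_measure V sign_space)"
      using assms
      by (intro measurable_compose[where f = "\<lambda>e. e i" and N = sign_space
            and g = "\<lambda>t. complex_of_real (t * a i)"] borel_measurable_sign_space) auto
    fix e assume "e \<in> space (pow_measure V sign_space)"
    then show "cmod (complex_of_real (e i * a i)) \<le> 1"
      using assms i by (auto simp: space_PiM PiE_def Pi_def space_uniform_count_measure abs_mult)
  qed (use assms in \<open>auto intro: finite_measure\<close>)
  then show ?thesis by (simp add: scaleR_scaleC)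
qed

text \<open>Coefficients are changed from 1 to \<open>a i\<close> one at a time. By convexity a
  coefficient in [-1, 1] is dominated by an average of the cases 1 and -1, and these two have equal
  integrals because the signs are symmetric.\<close>

lemma sign_contraction:
  fixes y :: "'i \<Rightarrow> 'a::complex_banach"
  assumes p: "1 \<le> p" and V: "finite V" and a: "\<And>i. i \<in> V \<Longrightarrow> \<bar>a i\<bar> \<le> 1"
  shows "(\<integral>e. norm (\<Sum>i\<in>V. (e i * a i) *\<^sub>R y i) powr p \<partial>pow_measure V sign_space)
    \<le> (\<integral>e. norm (\<Sum>i\<in>V. e i *\<^sub>R y i) powr p \<partial>pow_measure V sign_space)"
proof -
  let ?P = "pow_measure V sign_space"
  define G where "G b = (\<integral>e. norm (\<Sum>i\<in>V. (e i * b i) *\<^sub>R y i) powr p \<partial>?P)" for b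
  have step: "G (b(i := t)) \<le> G b"
    if i: "i \<in> V" and bi: "b i = 1" and b: "\<And>j. j \<in> V \<Longrightarrow> \<bar>b j\<bar> \<le> 1" and t: "\<bar>t\<bar> \<le> 1" for b i t
  proof -
    let ?c = "b(i := - 1)"
    let ?N = "\<lambda>b e. norm (\<Sum>j\<in>V. (e j * b j) *\<^sub>R y j) powr p"
    have int: "integrable ?P (?N b')" if "\<And>j. j \<in> V \<Longrightarrow> \<bar>b' j\<bar> \<le> 1" for b'
      using p V that by (intro integrable_sign_sum) auto
    have c: "\<bar>?c j\<bar> \<le> 1" if "j \<in> V" for j using b[OF that] by simp
    have bt: "\<bar>(b(i := t)) j\<bar> \<le> 1" if "j \<in> V" for j using b[OF that] t by simp
    have split: "(\<Sum>j\<in>V. (e j * (b(i := r)) j) *\<^sub>R y j)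
        = (\<Sum>j\<in>V - {i}. (e j * b j) *\<^sub>R y j) + r *\<^sub>R (e i *\<^sub>R y i)" for e r
      using i V by (subst sum.remove[OF V i]) (simp add: mult.commute add.commute)
    have "?N (b(i := t)) e \<le> (1 + t) / 2 * ?N b e + (1 - t) / 2 * ?N ?c e" for e
      using norm_powr_average[OF p t, of "\<Sum>j\<in>V - {i}. (e j * b j) *\<^sub>R y j" "e i *\<^sub>R y i"]
        split[of e t] split[of e "-1"] split[of e 1] bi by (simp add: fun_upd_idem)
    then have "G (b(i := t)) \<le> (\<integral>e. (1 + t) / 2 * ?N b e + (1 - t) / 2 * ?N ?c e \<partial>?P)"
      unfolding G_def using int[OF bt] int[OF c] int[OF b] by (intro integral_mono) auto
    also have "\<dots> = (1 + t) / 2 * G b + (1 - t) / 2 * G ?c"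
      unfolding G_def using int[OF c] int[OF b] by simp
    \<comment> \<open>Flipping the single sign \<open>e i\<close> preserves the measure and turns
      the coefficient -1 back into 1.\<close>
    also have "G ?c = G b"
    proof -
      let ?T = "\<lambda>j. if j = i then uminus else (\<lambda>e::real. e)"
      have "G ?c = (\<integral>e. ?N b (\<lambda>j\<in>V. ?T j (e j)) \<partial>?P)"
        unfolding G_def using bi
        by (intro Bochner_Integration.integral_cong refl arg_cong[where f = "\<lambda>v. norm v powr p"] sum.cong)
           auto
      also have "\<dots> = G b"
        unfolding G_def
        by (rule integral_pow_measure_coordinatewise[OF prob_space_sign_space V])
           (use int[OF b] in \<open>auto simp: measurable_uminus_sign_space distr_uminus_sign_space distr_id2\<close>)
      finally show ?thesis .
    qed
    also have "(1 + t) / 2 * G b + (1 - t) / 2 * G b = G b" by (simp add: field_simps)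
    finally show ?thesis .
  qed
  \<comment> \<open>\<open>W\<close> is the set of coordinates already changed; the others still
    carry the coefficient 1 that \<open>step\<close> requires.\<close>
  have "G (\<lambda>i. if i \<in> W then a i else 1) \<le> G (\<lambda>_. 1)" if "W \<subseteq> V" for W
    using finite_subset[OF that V] that
  proof (induction W)
    case (insert i W)
    have "(\<lambda>j. if j \<in> insert i W then a j else 1) = (\<lambda>j. if j \<in> W then a j else 1)(i := a i)"
      by auto
    moreover have "G ((\<lambda>j. if j \<in> W then a j else 1)(i := a i)) \<le> G (\<lambda>j. if j \<in> W then a j else 1)"
      using insert a by (intro step) auto
    ultimately show ?case using insert by simp
  qed simp
  from this[OF order_refl] have "G (\<lambda>i. if i \<in> V then a i else 1) \<le> G (\<lambda>_. 1)" .
  moreover have "G (\<lambda>i. if i \<in> V then a i else 1) = G a"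
    unfolding G_def
    by (intro Bochner_Integration.integral_cong refl arg_cong[where f = "\<lambda>v. norm v powr p"] sum.cong) auto
  ultimately show ?thesis by (simp add: G_def)
qed

text \<open>
  The factor 2 comes from \<open>x i = Re (z i) *\<^sub>R y i - Im (z i) *\<^sub>R \<i> *\<^sub>C y i\<close> with \<open>y i = z i *\<^sub>C x i\<close>.
\<close>
lemma sign_complex_contraction:
  fixes x :: "'i \<Rightarrow> 'a::complex_banach"
  assumes p: "1 \<le> p" and V: "finite V" and z: "\<And>i. i \<in> V \<Longrightarrow> cmod (z i) = 1"
  shows "(\<integral>e. norm (\<Sum>i\<in>V. e i *\<^sub>R x i) powr p \<partial>pow_measure V sign_space)
    \<le> 2 powr p * (\<integral>e. norm (\<Sum>i\<in>V. e i *\<^sub>R z i *\<^sub>C x i) powr p \<partial>pow_measure V sign_space)"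
proof -
  let ?P = "pow_measure V sign_space"
  define y where "y i = z i *\<^sub>C x i" for i
  let ?u = "\<lambda>e. \<Sum>i\<in>V. (e i * Re (z i)) *\<^sub>R y i"
  let ?v = "\<lambda>e. \<Sum>i\<in>V. (e i * Im (z i)) *\<^sub>R y i"
  \<comment> \<open>As \<open>z i\<close> has modulus 1, \<open>x i\<close> equals
    \<open>cnj (z i) *\<^sub>C y i\<close>. The real and imaginary parts of \<open>cnj (z i)\<close>
    are real coefficients of modulus at most 1, as the contraction principle requires.\<close>
  have x: "x i = Re (z i) *\<^sub>R y i + (- \<i>) *\<^sub>C Im (z i) *\<^sub>R y i" if "i \<in> V" for i
  proof -
    have "cnj (z i) * z i = 1" using z[OF that] by (simp add: complex_norm_square[symmetric] mult.commute)
    moreover have "cnj (z i) = of_real (Re (z i)) + (- \<i>) * of_real (Im (z i))"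
      by (simp add: complex_eq_iff)
    ultimately have "of_real (Re (z i)) * z i - \<i> * (of_real (Im (z i)) * z i) = 1"
      by (simp add: algebra_simps)
    then show ?thesis
      by (simp add: y_def scaleR_scaleC scaleC_scaleC scaleC_one flip: scaleC_add_left distrib_right)
  qed
  have sum: "(\<Sum>i\<in>V. e i *\<^sub>R x i) = ?u e + (- \<i>) *\<^sub>C ?v e" for e
  proof -
    have "(\<Sum>i\<in>V. e i *\<^sub>R x i) = (\<Sum>i\<in>V. (e i * Re (z i)) *\<^sub>R y i + (- \<i>) *\<^sub>C ((e i * Im (z i)) *\<^sub>R y i))"
      by (rule sum.cong[OF refl], subst x)
         (simp_all add: scaleR_scaleC scaleC_add_right scaleC_scaleC mult_ac)
    then show ?thesis by (simp add: sum.distrib scaleC_sum_right)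
  qed
  have ri: "\<bar>Re (z i)\<bar> \<le> 1" "\<bar>Im (z i)\<bar> \<le> 1" if "i \<in> V" for i
    using z[OF that] abs_Re_le_cmod[of "z i"] abs_Im_le_cmod[of "z i"] by auto
  have iu: "integrable ?P (\<lambda>e. norm (?u e) powr p)" and iv: "integrable ?P (\<lambda>e. norm (?v e) powr p)"
    using p V ri by (auto intro!: integrable_sign_sum)
  have "(\<integral>e. norm (\<Sum>i\<in>V. e i *\<^sub>R x i) powr p \<partial>?P)
      \<le> (\<integral>e. 2 powr p * ((norm (?u e) powr p + norm (?v e) powr p) / 2) \<partial>?P)"
  proof (rule integral_mono')
    show "norm (\<Sum>i\<in>V. e i *\<^sub>R x i) powr p \<le> 2 powr p * ((norm (?u e) powr p + norm (?v e) powr p) / 2)" for e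
      unfolding sum using norm_add_powr_le[OF p, of "?u e" "(- \<i>) *\<^sub>C ?v e"] by (simp add: norm_scaleC)
  qed (use iu iv in auto)
  also have "\<dots> = 2 powr p * (((\<integral>e. norm (?u e) powr p \<partial>?P) + (\<integral>e. norm (?v e) powr p \<partial>?P)) / 2)"
    using iu iv by simp
  also have "\<dots> \<le> 2 powr p * (\<integral>e. norm (\<Sum>i\<in>V. e i *\<^sub>R y i) powr p \<partial>?P)"
    using sign_contraction[OF p V, of "\<lambda>i. Re (z i)" y] sign_contraction[OF p V, of "\<lambda>i. Im (z i)" y] ri
    by (intro mult_left_mono) auto
  finally show ?thesis unfolding y_def .
qed

subsection \<open>Polynomials in independent variables\<close>

text \<open>
  The probability of drawing \<open>S\<close> when each element of \<open>V\<close> is selected independently with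
  probability \<open>q\<close>.
\<close>
definition bernoulli_weight :: "real \<Rightarrow> 'i set \<Rightarrow> 'i set \<Rightarrow> real" where
  "bernoulli_weight q V S = (\<Prod>i\<in>S. q) * (\<Prod>i\<in>V - S. 1 - q)"

lemma bernoulli_weight_nonneg: "0 \<le> q \<Longrightarrow> q \<le> 1 \<Longrightarrow> 0 \<le> bernoulli_weight q V S"
  unfolding bernoulli_weight_def by (intro mult_nonneg_nonneg prod_nonneg) auto

lemma sum_bernoulli_weight: "finite V \<Longrightarrow> (\<Sum>S\<in>Pow V. bernoulli_weight q V S) = 1"
  unfolding bernoulli_weight_def by (subst prod_add[symmetric]) auto

text \<open>This is the binomial probability of exactly one success in \<open>Suc s\<close> trials,
  obtained by summing over the point \<open>i\<close> at which \<open>S\<close> meets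
  \<open>A\<close>.\<close>

lemma sum_bernoulli_weight_meet_once:
  fixes q :: real
  assumes V: "finite V" and A: "A \<subseteq> V" "card A = Suc s"
  shows "(\<Sum>S\<in>{S\<in>Pow V. card (S \<inter> A) = 1}. bernoulli_weight q V S) = Suc s * q * (1 - q) ^ s"
proof -
  let ?w = "bernoulli_weight q V"
  have fA: "finite A" using A V finite_subset by auto
  have one: "(\<Sum>S\<in>{S\<in>Pow V. S \<inter> A = {i}}. ?w S) = q * (1 - q) ^ s" if i: "i \<in> A" for i
  proof -
    \<comment> \<open>The event \<open>S \<inter> A = {i}\<close> is encoded in the factors:
      \<open>?f\<close> vanishes if \<open>S\<close> contains another point of \<open>A\<close>, and
      \<open>?g\<close> vanishes if \<open>S\<close> misses \<open>i\<close>. The sum over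
      \<open>S\<close> then factorises.\<close>
    let ?f = "\<lambda>j. if j \<in> A - {i} then 0 else q"
    let ?g = "\<lambda>j. if j = i then 0 else 1 - q"
    have val: "(\<Prod>j\<in>S. ?f j) * (\<Prod>j\<in>V - S. ?g j) = (if S \<inter> A = {i} then ?w S else 0)"
      if "S \<in> Pow V" for S
    proof (cases "S \<inter> A = {i}")
      case True
      have "(\<Prod>j\<in>S. ?f j) = (\<Prod>j\<in>S. q)" using True by (intro prod.cong) auto
      moreover have "(\<Prod>j\<in>V - S. ?g j) = (\<Prod>j\<in>V - S. 1 - q)" using True by (intro prod.cong) auto
      ultimately show ?thesis using True by (simp add: bernoulli_weight_def)
    next
      case False
      have fS: "finite S" using that V finite_subset by auto
      from False consider j where "j \<in> S" "j \<in> A - {i}" | "i \<notin> S" using i by auto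
      then show ?thesis
      proof cases
        case 1
        then have "(\<Prod>j\<in>S. ?f j) = 0" using fS by (intro prod_zero) auto
        then show ?thesis using False by simp
      next
        case 2
        then have "(\<Prod>j\<in>V - S. ?g j) = 0" using V A i by (intro prod_zero) auto
        then show ?thesis using False by simp
      qed
    qed
    have "(\<Sum>S\<in>{S\<in>Pow V. S \<inter> A = {i}}. ?w S) = (\<Sum>S\<in>Pow V. if S \<inter> A = {i} then ?w S else 0)"
      using V by (subst sum.inter_filter) auto
    also have "\<dots> = (\<Sum>S\<in>Pow V. (\<Prod>j\<in>S. ?f j) * (\<Prod>j\<in>V - S. ?g j))"
      by (rule sum.cong[OF refl]) (simp only: val)
    also have "\<dots> = (\<Prod>j\<in>V. ?f j + ?g j)"
      by (rule prod_add[OF V, symmetric])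
    \<comment> \<open>Outside \<open>A\<close> each factor is
      \<open>q + (1 - q) = 1\<close>.\<close>
    also have "\<dots> = (\<Prod>j\<in>A. ?f j + ?g j)"
      using V A i by (intro prod.mono_neutral_right) auto
    also have "\<dots> = q * (\<Prod>j\<in>A - {i}. 1 - q)"
      using fA i by (subst prod.remove[OF fA i]) auto
    finally show ?thesis using A(2) i by simp
  qed
  have "{S\<in>Pow V. card (S \<inter> A) = 1} = (\<Union>i\<in>A. {S\<in>Pow V. S \<inter> A = {i}})"
    by (auto simp: card_1_singleton_iff)
  then have "(\<Sum>S\<in>{S\<in>Pow V. card (S \<inter> A) = 1}. ?w S)
      = (\<Sum>i\<in>A. \<Sum>S\<in>{S\<in>Pow V. S \<inter> A = {i}}. ?w S)"
    using fA V by (simp only:) (subst sum.UNION_disjoint, auto)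
  also have "\<dots> = Suc s * q * (1 - q) ^ s" using one A(2) by simp
  finally show ?thesis .
qed

text \<open>For positive \<open>s\<close> the base is the reciprocal of \<open>1 + 1 / s\<close>,
  and \<open>(1 + 1 / s) ^ s\<close> is at most \<open>exp 1\<close>. The probability of meeting
  once is thus bounded below uniformly in \<open>s\<close>.\<close>

lemma exp_le_meet_once:
  "exp (- 1) \<le> (1 - 1 / real (Suc s)) ^ s"
proof (cases "s = 0")
  case False
  have "(1 + 1 / real s) ^ s \<le> exp 1"
    by (rule exp_ge_one_plus_x_over_n_power_n) (use False in auto)
  moreover have "1 - 1 / real (Suc s) = inverse (1 + 1 / real s)" using False by (simp add: field_simps)
  ultimately show ?thesis
    by (simp add: exp_minus power_inverse le_imp_inverse_le add_pos_nonneg)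
qed simp

section \<open>Polynomial estimates over an abstract product system\<close>

lemma power_powr_commute: "0 < b \<Longrightarrow> (b ^ n) powr p = (b powr p) ^ n" for b p :: real
  by (induction n) (auto simp: powr_mult)

text \<open>A common frame for torus and sign cube: \<open>\<phi> k\<close> stands for the
  \<open>k\<close>-th power of a variable. The condition on \<open>\<phi> 0\<close> makes exponent 0
  mean that the variable is absent.\<close>

locale product_system =
  fixes M :: "'w measure" and \<phi> :: "nat \<Rightarrow> 'w \<Rightarrow> complex" and V :: "'i set"
  assumes M: "prob_space M" and V: "finite V"
    and \<phi>_measurable: "\<And>k. \<phi> k \<in> borel_measurable M"
    and \<phi>_bound: "\<And>k w. w \<in> space M \<Longrightarrow> cmod (\<phi> k w) \<le> 1"
    and \<phi>_0: "\<And>w. w \<in> space M \<Longrightarrow> \<phi> 0 w = 1"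
begin

abbreviation P :: "('i \<Rightarrow> 'w) measure" where
  "P \<equiv> pow_measure V M"

sublocale P: prob_space P
  by (rule prob_space_pow_measure[OF M])

definition mon :: "('i \<Rightarrow> nat) \<Rightarrow> ('i \<Rightarrow> 'w) \<Rightarrow> complex" where
  "mon b w = (\<Prod>i\<in>V. \<phi> (b i) (w i))"

lemma space_component: "w \<in> space P \<Longrightarrow> i \<in> V \<Longrightarrow> w i \<in> space M"
  by (auto simp: space_PiM)

lemma mon_measurable: "mon b \<in> borel_measurable P"
  unfolding mon_def
proof (rule borel_measurable_prod)
  fix i assume "i \<in> V"
  then show "(\<lambda>w. \<phi> (b i) (w i)) \<in> borel_measurable P"
    by (intro measurable_compose[where f = "\<lambda>w. w i", OF _ \<phi>_measurable]) auto
qed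

lemma mon_bound: "w \<in> space P \<Longrightarrow> cmod (mon b w) \<le> 1"
  unfolding mon_def prod_norm[symmetric]
  by (intro prod_le_1 conjI \<phi>_bound space_component norm_ge_zero)

lemma integrable_mon_sum:
  fixes x :: "'j \<Rightarrow> 'a::complex_banach"
  assumes "0 \<le> p" "finite J"
  shows "integrable P (\<lambda>w. norm (\<Sum>j\<in>J. mon (a j) w *\<^sub>C x j) powr p)"
  using assms
  by (intro integrable_norm_sum_scaleC mon_measurable mon_bound P.finite_measure_axioms) auto

lemma mon_remove:
  assumes "i \<in> V" "w \<in> space P"
  shows "mon b w = \<phi> (b i) (w i) * mon (b(i := 0)) w"
proof -
  have "mon (b(i := 0)) w = (\<Prod>l\<in>V - {i}. \<phi> (b l) (w l))"
    unfolding mon_def using assms V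
    by (subst prod.remove[OF V assms(1)]) (auto intro!: prod.cong simp: \<phi>_0 space_component)
  then show ?thesis unfolding mon_def using V assms(1) by (simp add: prod.remove)
qed

text \<open>Variables of exponent 0 contribute the constant 1, so a monomial depends only on the
  coordinates in its support. This allows resampling the remaining coordinates.\<close>

lemma mon_cong:
  assumes "w \<in> space P" "w' \<in> space P" "\<And>i. i \<in> V \<Longrightarrow> b i \<noteq> 0 \<Longrightarrow> w i = w' i"
  shows "mon b w = mon b w'"
  unfolding mon_def
proof (rule prod.cong[OF refl])
  fix i assume "i \<in> V"
  then show "\<phi> (b i) (w i) = \<phi> (b i) (w' i)"
    using assms by (cases "b i = 0") (auto simp: \<phi>_0 space_component)
qed

text \<open>
  The terms are grouped by the unique index \<open>i\<close> at which the support of \<open>a j\<close> meets \<open>S\<close> and by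
  the exponent \<open>k\<close> there. For fixed \<open>k\<close> the remaining factors depend on the coordinates outside
  \<open>S\<close> only, so the type inequality applies conditionally on these.
\<close>
lemma block_bound:
  fixes x :: "'j \<Rightarrow> 'a::complex_banach"
  assumes p: "1 \<le> p" and R: "0 \<le> R"
    and type: "\<And>k y :: 'i \<Rightarrow> 'a. 1 \<le> k \<Longrightarrow>
      (\<integral>w. norm (\<Sum>i\<in>V. \<phi> k (w i) *\<^sub>C y i) powr p \<partial>P) \<le> R * (\<Sum>i\<in>V. norm (y i) powr p)"
    and J: "finite J" and S: "S \<subseteq> V"
    and i: "\<And>j. j \<in> J \<Longrightarrow> \<iota> j \<in> S" "\<And>j. j \<in> J \<Longrightarrow> S \<inter> {i\<in>V. a j i \<noteq> 0} = {\<iota> j}"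
  shows "(\<integral>w. norm (\<Sum>j\<in>J. mon (a j) w *\<^sub>C x j) powr p \<partial>P)
    \<le> (\<Sum>k\<in>(\<lambda>j. a j (\<iota> j)) ` J. (2 powr p) ^ k * (R * (\<Sum>i\<in>S.
        (\<integral>w. norm (\<Sum>j\<in>{j\<in>J. \<iota> j = i \<and> a j i = k}. mon ((a j)(i := 0)) w *\<^sub>C x j) powr p \<partial>P))))"
proof -
  define K where "K = (\<lambda>j. a j (\<iota> j)) ` J"
  \<comment> \<open>\<open>h k\<close> collects the terms with exponent \<open>k\<close> at the
    meeting index; \<open>g k i\<close> is the cofactor of \<open>\<phi> k (w i)\<close> in
    it.\<close>
  define g where "g k i w = (\<Sum>j\<in>{j\<in>J. \<iota> j = i \<and> a j i = k}. mon ((a j)(i := 0)) w *\<^sub>C x j)" for k i w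
  define h where "h k w = (\<Sum>j\<in>{j\<in>J. a j (\<iota> j) = k}. mon (a j) w *\<^sub>C x j)" for k w
  have fS: "finite S" using S V finite_subset by auto
  have fK: "finite K" using J by (simp add: K_def)
  have K1: "1 \<le> k" if "k \<in> K" for k
    using that i(2) by (force simp: K_def)
  have p0: "0 \<le> p" using p by simp
  have int_h: "integrable P (\<lambda>w. norm (h k w) powr p)" for k
    unfolding h_def using J p0 by (intro integrable_mon_sum) auto
  have int_g: "integrable P (\<lambda>w. norm (g k i w) powr p)" for k i
    unfolding g_def using J p0 by (intro integrable_mon_sum) auto
  have h_g: "h k w = (\<Sum>i\<in>S. \<phi> k (w i) *\<^sub>C g k i w)" if w: "w \<in> space P" for k w
  proof -
    have "h k w = (\<Sum>i\<in>S. \<Sum>j\<in>{j\<in>{j\<in>J. a j (\<iota> j) = k}. \<iota> j = i}. mon (a j) w *\<^sub>C x j)"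
      unfolding h_def using J fS i(1) by (intro sum.group[symmetric]) auto
    also have "\<dots> = (\<Sum>i\<in>S. \<phi> k (w i) *\<^sub>C g k i w)"
    proof (rule sum.cong[OF refl])
      fix i assume "i \<in> S"
      then have iV: "i \<in> V" using S by auto
      have "{j\<in>{j\<in>J. a j (\<iota> j) = k}. \<iota> j = i} = {j\<in>J. \<iota> j = i \<and> a j i = k}" by auto
      then show "(\<Sum>j\<in>{j\<in>{j\<in>J. a j (\<iota> j) = k}. \<iota> j = i}. mon (a j) w *\<^sub>C x j) = \<phi> k (w i) *\<^sub>C g k i w"
        unfolding g_def scaleC_sum_right 
      proof (rule sum.cong)
        fix j assume "j \<in> {j\<in>J. \<iota> j = i \<and> a j i = k}"
        then show "mon (a j) w *\<^sub>C x j = \<phi> k (w i) *\<^sub>C mon ((a j)(i := 0)) w *\<^sub>C x j"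
          using mon_remove[OF iV w, of "a j"] by (simp add: scaleC_scaleC)
      qed
    qed
    finally show ?thesis .
  qed
  have int_bound: "(\<integral>w. norm (h k w) powr p \<partial>P) \<le> R * (\<Sum>i\<in>S. \<integral>w. norm (g k i w) powr p \<partial>P)"
    if k: "k \<in> K" for k
  proof -
    let ?m = "\<lambda>w w'. \<lambda>i\<in>V. if i \<in> S then w i else w' i"
    have "(\<integral>w. norm (h k w) powr p \<partial>P) = (\<integral>w'. (\<integral>w. norm (h k (?m w w')) powr p \<partial>P) \<partial>P)"
      by (rule integral_pow_measure_split[OF M V S int_h])
    also have "\<dots> \<le> (\<integral>w'. R * (\<Sum>i\<in>S. norm (g k i w') powr p) \<partial>P)"
    proof (rule integral_mono')
      show "integrable P (\<lambda>w'. R * (\<Sum>i\<in>S. norm (g k i w') powr p))"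
        using int_g by auto
      show "0 \<le> R * (\<Sum>i\<in>S. norm (g k i w') powr p)" for w'
        using R by (intro mult_nonneg_nonneg sum_nonneg) auto
      fix w' assume w': "w' \<in> space P"
      \<comment> \<open>The type inequality ranges over all of \<open>V\<close>, so the cofactors
        are extended by 0 outside \<open>S\<close>.\<close>
      let ?y = "\<lambda>i. if i \<in> S then g k i w' else 0"
      have "h k (?m w w') = (\<Sum>i\<in>V. \<phi> k (w i) *\<^sub>C ?y i)" if w: "w \<in> space P" for w
      proof -
        have m: "?m w w' \<in> space P" using w w' by (auto simp: space_PiM PiE_def Pi_def)
        \<comment> \<open>Once the exponent at \<open>i\<close> is set to 0, the monomials have no
          variable left in \<open>S\<close>, so resampling \<open>S\<close> does not change the
          cofactor.\<close>
        have "g k i (?m w w') = g k i w'" if "i \<in> S" for i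
          unfolding g_def
        proof (rule sum.cong[OF refl])
          fix j assume j: "j \<in> {j\<in>J. \<iota> j = i \<and> a j i = k}"
          have "mon ((a j)(i := 0)) (?m w w') = mon ((a j)(i := 0)) w'"
            
          proof (intro mon_cong m w')
            fix l assume l: "l \<in> V" "((a j)(i := 0)) l \<noteq> 0"
            then have "l \<notin> S" using i(2)[of j] j by (auto split: if_splits)
            then show "?m w w' l = w' l" using l(1) by simp
          qed
          then show "mon ((a j)(i := 0)) (?m w w') *\<^sub>C x j = mon ((a j)(i := 0)) w' *\<^sub>C x j" by simp
        qed
        then have "h k (?m w w') = (\<Sum>i\<in>S. \<phi> k (w i) *\<^sub>C ?y i)"
          unfolding h_g[OF m] using S by (intro sum.cong) auto
        also have "\<dots> = (\<Sum>i\<in>V. \<phi> k (w i) *\<^sub>C ?y i)"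
          using S V by (intro sum.mono_neutral_left) (auto simp: scaleC_zero_right)
        finally show ?thesis .
      qed
      then have "(\<integral>w. norm (h k (?m w w')) powr p \<partial>P)
          = (\<integral>w. norm (\<Sum>i\<in>V. \<phi> k (w i) *\<^sub>C ?y i) powr p \<partial>P)"
        by (intro Bochner_Integration.integral_cong) auto
      also have "\<dots> \<le> R * (\<Sum>i\<in>V. norm (?y i) powr p)"
        by (rule type[OF K1[OF k]])
      also have "(\<Sum>i\<in>V. norm (?y i) powr p) = (\<Sum>i\<in>S. norm (g k i w') powr p)"
        using S V by (intro sum.mono_neutral_cong_right) auto
      finally show "(\<integral>w. norm (h k (?m w w')) powr p \<partial>P) \<le> R * (\<Sum>i\<in>S. norm (g k i w') powr p)" .
    qed
    also have "\<dots> = R * (\<Sum>i\<in>S. \<integral>w. norm (g k i w) powr p \<partial>P)"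
      using int_g by (simp add: integral_sum)
    finally show ?thesis .
  qed
  \<comment> \<open>All exponents in \<open>K\<close> are at least 1, so the geometric weights have
    mass at most 1. They cost \<open>(2 powr p) ^ k\<close>, which the later induction charges to
    the \<open>k\<close> degrees removed.\<close>
  have geo: "(\<Sum>k\<in>K. (1/2) ^ k) \<le> (1::real)"
  proof -
    have "(\<Sum>k\<in>K. (1/2) ^ k) \<le> (\<Sum>k. (1/2) ^ Suc k :: real)"
    proof -
      have "(\<Sum>k\<in>K. (1/2) ^ k :: real) = (\<Sum>k\<in>(\<lambda>k. k - 1) ` K. (1/2) ^ Suc k)"
      proof (rule sum.reindex_cong)
        show "inj_on Suc ((\<lambda>k. k - 1) ` K)" by simp
        show "K = Suc ` (\<lambda>k. k - 1) ` K" using K1 by (force simp: image_image)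
      qed simp
      also have "\<dots> \<le> (\<Sum>k. (1/2) ^ Suc k)"
        using fK by (intro sum_le_suminf) (auto intro: sums_summable[OF power_half_series])
      finally show ?thesis .
    qed
    then show ?thesis using sums_unique[OF power_half_series] by simp
  qed
  have "norm (\<Sum>j\<in>J. mon (a j) w *\<^sub>C x j) powr p \<le> (\<Sum>k\<in>K. (2 powr p) ^ k * norm (h k w) powr p)" for w
  proof -
    have "(\<Sum>j\<in>J. mon (a j) w *\<^sub>C x j) = (\<Sum>k\<in>K. h k w)"
      unfolding h_def using J fK by (intro sum.group[symmetric]) (auto simp: K_def)
    also have "\<dots> = (\<Sum>k\<in>K. (1/2) ^ k *\<^sub>R (2 ^ k *\<^sub>R h k w))"
      by (simp add: power_one_over)
    also have "norm \<dots> powr p \<le> (\<Sum>k\<in>K. (1/2) ^ k * norm (2 ^ k *\<^sub>R h k w) powr p)"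
      using geo by (intro norm_sum_powr_le[OF p fK]) auto
    also have "\<dots> \<le> (\<Sum>k\<in>K. 1 * norm (2 ^ k *\<^sub>R h k w) powr p)"
      by (intro sum_mono mult_right_mono) (auto simp: power_le_one)
    also have "\<dots> = (\<Sum>k\<in>K. (2 powr p) ^ k * norm (h k w) powr p)"
      by (simp add: powr_mult power_powr_commute mult.commute)
    finally show ?thesis .
  qed
  then have "(\<integral>w. norm (\<Sum>j\<in>J. mon (a j) w *\<^sub>C x j) powr p \<partial>P)
      \<le> (\<integral>w. (\<Sum>k\<in>K. (2 powr p) ^ k * norm (h k w) powr p) \<partial>P)"
    using int_h by (intro integral_mono' sum_nonneg) auto
  also have "\<dots> = (\<Sum>k\<in>K. (2 powr p) ^ k * (\<integral>w. norm (h k w) powr p \<partial>P))"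
    using int_h by (simp add: integral_sum)
  also have "\<dots> \<le> (\<Sum>k\<in>K. (2 powr p) ^ k * (R * (\<Sum>i\<in>S. \<integral>w. norm (g k i w) powr p \<partial>P)))"
    by (intro sum_mono mult_left_mono int_bound) auto
  finally show ?thesis unfolding K_def g_def .
qed

text \<open>Homogeneity refers to the number \<open>s\<close> of variables in each monomial, not to
  its degree. In the induction on \<open>s\<close>, averaging over \<open>S\<close> and
  \<open>block_bound\<close> remove one variable with its exponent \<open>k\<close>; the total loss
  is at most \<open>D ^ k\<close>, which the drop in degree compensates.\<close>

lemma homogeneous_bound:
  fixes x :: "'j \<Rightarrow> 'a::complex_banach"
  assumes p: "1 \<le> p" and R: "1 \<le> R"
    and type: "\<And>k y :: 'i \<Rightarrow> 'a. 1 \<le> k \<Longrightarrow>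
      (\<integral>w. norm (\<Sum>i\<in>V. \<phi> k (w i) *\<^sub>C y i) powr p \<partial>P) \<le> R * (\<Sum>i\<in>V. norm (y i) powr p)"
    and D: "D = 2 powr p * (exp p * R)"
    and "finite J"
    and "\<And>j j'. j \<in> J \<Longrightarrow> j' \<in> J \<Longrightarrow> (\<forall>i\<in>V. a j i = a j' i) \<Longrightarrow> j = j'"
    and "\<And>j. j \<in> J \<Longrightarrow> card {i\<in>V. a j i \<noteq> 0} = s"
  shows "(\<integral>w. norm (\<Sum>j\<in>J. mon (a j) w *\<^sub>C x j) powr p \<partial>P)
    \<le> (\<Sum>j\<in>J. D ^ (\<Sum>i\<in>V. a j i) * norm (x j) powr p)"
  using assms(5-)
proof (induction s arbitrary: J a)
  case 0
  \<comment> \<open>Without variables every monomial is constant, and injectivity of the exponents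
    leaves at most one term.\<close>
  have zero: "a j i = 0" if "j \<in> J" "i \<in> V" for j i
    using "0.prems"(3)[OF that(1)] that V by auto
  show ?case
  proof (cases "J = {}")
    case False
    then obtain j where j: "j \<in> J" by auto
    have "j' = j" if "j' \<in> J" for j'
      by (rule "0.prems"(2)[OF that j]) (simp add: zero that j)
    then have "J = {j}" using j by blast
    moreover have "(\<integral>w. norm (mon (a j) w *\<^sub>C x j) powr p \<partial>P) = (\<integral>w. norm (x j) powr p \<partial>P)"
      using zero[OF j]
      by (intro Bochner_Integration.integral_cong) (auto simp: mon_def \<phi>_0 space_component scaleC_one)
    ultimately show ?thesis using zero by (simp add: P.prob_space)
  qed simp
next
  case (Suc s)
  define B where "B = (\<Sum>j\<in>J. D ^ (\<Sum>i\<in>V. a j i) * norm (x j) powr p)"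
  define supp where "supp j = {i\<in>V. a j i \<noteq> 0}" for j
  define f where "f S w = (\<Sum>j\<in>{j\<in>J. card (S \<inter> supp j) = 1}. mon (a j) w *\<^sub>C x j)" for S w
  have p0: "0 \<le> p" using p by simp
  have int_f: "integrable P (\<lambda>w. norm (f S w) powr p)" for S
    unfolding f_def using Suc.prems(1) p0 by (intro integrable_mon_sum) auto
  have E: "1 \<le> exp p * R" using p R by (intro mult_ge1_I) auto
  have D0: "0 < D" using E by (simp add: D)
  \<comment> \<open>The factor \<open>exp p\<close> pays for the averaging over \<open>S\<close>,
    \<open>(2 powr p) ^ k\<close> for separating the exponents and \<open>R\<close> for type. As
    \<open>k\<close> is at least 1 and \<open>exp p * R\<close> is at least 1, \<open>D ^ k\<close>
    covers all three.\<close>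
  have Dk: "exp p * ((2 powr p) ^ k * (R * D ^ (n - k))) \<le> D ^ n" if "1 \<le> k" "k \<le> n" for k n
  proof -
    have "exp p * R \<le> (exp p * R) ^ k" using E that by (intro self_le_power) auto
    then have "(2 powr p) ^ k * (exp p * R) \<le> D ^ k"
      unfolding D power_mult_distrib by (intro mult_left_mono) auto
    then have "(2 powr p) ^ k * (exp p * R) * D ^ (n - k) \<le> D ^ k * D ^ (n - k)"
      using D0 by (intro mult_right_mono) auto
    also have "\<dots> = D ^ n" using that by (simp flip: power_add)
    finally show ?thesis by (simp add: mult_ac)
  qed
  have block: "exp p * (\<integral>w. norm (f S w) powr p \<partial>P) \<le> B" if S: "S \<subseteq> V" for S
  proof -
    define J' where "J' = {j\<in>J. card (S \<inter> supp j) = 1}"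
    define \<iota> where "\<iota> j = the_elem (S \<inter> supp j)" for j
    define K where "K = (\<lambda>j. a j (\<iota> j)) ` J'"
    define Q where "Q k i = {j\<in>J'. \<iota> j = i \<and> a j i = k}" for k i
    have fJ: "finite J'" and J'J: "J' \<subseteq> J" and fK: "finite K" and fS: "finite S"
      using Suc.prems(1) S V finite_subset by (auto simp: J'_def K_def)
    have \<iota>: "S \<inter> supp j = {\<iota> j}" if "j \<in> J'" for j
    proof -
      from that obtain l where "S \<inter> supp j = {l}" by (auto simp: J'_def card_1_singleton_iff)
      then show ?thesis by (simp add: \<iota>_def)
    qed
    have \<iota>': "\<iota> j \<in> S" "\<iota> j \<in> V" "a j (\<iota> j) \<noteq> 0" if "j \<in> J'" for j
      using \<iota>[OF that] by (auto simp: supp_def)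
    \<comment> \<open>Members of \<open>Q k i\<close> share the exponent \<open>k\<close> at
      \<open>i\<close>, so they stay distinct when it is set to 0. They then have \<open>s\<close>
      variables and degree smaller by \<open>k\<close>.\<close>
    have IH: "(\<integral>w. norm (\<Sum>j\<in>Q k i. mon ((a j)(i := 0)) w *\<^sub>C x j) powr p \<partial>P)
        \<le> (\<Sum>j\<in>Q k i. D ^ ((\<Sum>l\<in>V. a j l) - k) * norm (x j) powr p)" if k: "k \<in> K" and i: "i \<in> S" for k i
    proof -
      have iV: "i \<in> V" using i S by auto
      have "(\<integral>w. norm (\<Sum>j\<in>Q k i. mon ((a j)(i := 0)) w *\<^sub>C x j) powr p \<partial>P)
          \<le> (\<Sum>j\<in>Q k i. D ^ (\<Sum>l\<in>V. ((a j)(i := 0)) l) * norm (x j) powr p)"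
      proof (rule Suc.IH)
        show "finite (Q k i)" using fJ by (simp add: Q_def)
        show "j = j'" if "j \<in> Q k i" "j' \<in> Q k i" "\<forall>l\<in>V. ((a j)(i := 0)) l = ((a j')(i := 0)) l" for j j'
        proof (rule Suc.prems(2))
          show "\<forall>l\<in>V. a j l = a j' l"
            using that by (auto simp: Q_def split: if_splits)
        qed (use that J'J in \<open>auto simp: Q_def\<close>)
        show "card {l\<in>V. ((a j)(i := 0)) l \<noteq> 0} = s" if j: "j \<in> Q k i" for j
        proof -
          have "{l\<in>V. ((a j)(i := 0)) l \<noteq> 0} = supp j - {i}" by (auto simp: supp_def)
          moreover have "i \<in> supp j" using j \<iota>[of j] by (auto simp: Q_def)
          moreover have "card (supp j) = Suc s"
            using Suc.prems(3)[of j] j J'J by (auto simp: Q_def supp_def)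
          ultimately show ?thesis by simp
        qed
      qed
      also have "\<dots> = (\<Sum>j\<in>Q k i. D ^ ((\<Sum>l\<in>V. a j l) - k) * norm (x j) powr p)"
      proof (rule sum.cong[OF refl])
        fix j assume j: "j \<in> Q k i"
        have "(\<Sum>l\<in>V. ((a j)(i := 0)) l) = (\<Sum>l\<in>V - {i}. a j l)"
          using V iV by (subst sum.remove[OF V iV]) (auto intro!: sum.cong)
        also have "\<dots> = (\<Sum>l\<in>V. a j l) - k"
          using j by (subst sum.remove[OF V iV]) (auto simp: Q_def)
        finally show "D ^ (\<Sum>l\<in>V. ((a j)(i := 0)) l) * norm (x j) powr p
            = D ^ ((\<Sum>l\<in>V. a j l) - k) * norm (x j) powr p" by simp
      qed
      finally show ?thesis .
    qed
    have "exp p * (\<integral>w. norm (f S w) powr p \<partial>P)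
        \<le> exp p * (\<Sum>k\<in>K. (2 powr p) ^ k * (R * (\<Sum>i\<in>S.
          (\<integral>w. norm (\<Sum>j\<in>Q k i. mon ((a j)(i := 0)) w *\<^sub>C x j) powr p \<partial>P))))"
      unfolding f_def J'_def[symmetric] K_def Q_def using \<iota> \<iota>' R
      by (intro mult_left_mono block_bound[OF p _ type fJ S]) (auto simp: supp_def)
    also have "\<dots> \<le> exp p * (\<Sum>k\<in>K. (2 powr p) ^ k * (R * (\<Sum>i\<in>S.
        (\<Sum>j\<in>Q k i. D ^ ((\<Sum>l\<in>V. a j l) - k) * norm (x j) powr p))))"
      using R by (intro mult_left_mono sum_mono IH) auto
    also have "\<dots> = (\<Sum>k\<in>K. \<Sum>i\<in>S. \<Sum>j\<in>Q k i.
        exp p * ((2 powr p) ^ k * (R * D ^ ((\<Sum>l\<in>V. a j l) - k))) * norm (x j) powr p)"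
      by (simp add: sum_distrib_left mult_ac)
    also have "\<dots> \<le> (\<Sum>k\<in>K. \<Sum>i\<in>S. \<Sum>j\<in>Q k i. D ^ (\<Sum>l\<in>V. a j l) * norm (x j) powr p)"
    proof (intro sum_mono mult_right_mono Dk)
      fix k i j assume "i \<in> S" and j: "j \<in> Q k i"
      then have "i \<in> V" using S by auto
      show "1 \<le> k" using j \<iota>'(3)[of j] by (auto simp: Q_def)
      have "a j i \<le> (\<Sum>l\<in>V. a j l)" by (rule member_le_sum) (use V \<open>i \<in> V\<close> in auto)
      then show "k \<le> (\<Sum>l\<in>V. a j l)" using j by (auto simp: Q_def)
    qed simp
    \<comment> \<open>The sets \<open>Q k i\<close> partition \<open>J'\<close>, so no coefficient
      is counted twice.\<close>
    also have "\<dots> = (\<Sum>k\<in>K. \<Sum>j\<in>{j\<in>J'. a j (\<iota> j) = k}. D ^ (\<Sum>l\<in>V. a j l) * norm (x j) powr p)"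
    proof (rule sum.cong[OF refl])
      fix k
      have "Q k i = {j\<in>{j\<in>J'. a j (\<iota> j) = k}. \<iota> j = i}" for i by (auto simp: Q_def)
      then show "(\<Sum>i\<in>S. \<Sum>j\<in>Q k i. D ^ (\<Sum>l\<in>V. a j l) * norm (x j) powr p)
          = (\<Sum>j\<in>{j\<in>J'. a j (\<iota> j) = k}. D ^ (\<Sum>l\<in>V. a j l) * norm (x j) powr p)"
        using fJ fS \<iota>'(1) by (simp only:) (intro sum.group, auto)
    qed
    also have "\<dots> = (\<Sum>j\<in>J'. D ^ (\<Sum>l\<in>V. a j l) * norm (x j) powr p)"
      using fJ fK by (intro sum.group) (auto simp: K_def)
    also have "\<dots> \<le> B"
      unfolding B_def using D0 Suc.prems(1) J'J by (intro sum_mono2) auto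
    finally show ?thesis .
  qed
  \<comment> \<open>With this choice \<open>Suc s * q = 1\<close>, so the probability of meeting a
    support exactly once is \<open>c\<close>, the same for every term.\<close>
  define q where "q = 1 / real (Suc s)"
  define w where "w = bernoulli_weight q V"
  define c where "c = (1 - q) ^ s"
  have w: "\<forall>S. 0 \<le> w S" "(\<Sum>S\<in>Pow V. w S) = 1"
    unfolding w_def using V by (auto simp: bernoulli_weight_nonneg q_def sum_bernoulli_weight)
  have c: "exp (- 1) \<le> c" unfolding c_def q_def by (rule exp_le_meet_once)
  have wc: "(\<Sum>S\<in>{S\<in>Pow V. card (S \<inter> A) = 1}. w S) = c" if "A \<subseteq> V" "card A = Suc s" for A
    unfolding w_def sum_bernoulli_weight_meet_once[OF V that] c_def by (simp add: q_def)
  have c0: "0 < c" using c exp_gt_zero[of "- 1 :: real"] by linarith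
  have fP: "finite (Pow V)" using V by simp
  have "norm (\<Sum>j\<in>J. mon (a j) z *\<^sub>C x j) powr p \<le> (\<Sum>S\<in>Pow V. w S * (exp p * norm (f S z) powr p))" for z
  proof -
    let ?v = "\<lambda>j. mon (a j) z *\<^sub>C x j"
    \<comment> \<open>Each term occurs in the blocks \<open>f S\<close> with total weight
      \<open>c\<close>; dividing by \<open>c\<close> therefore recovers the whole polynomial as an
      average of blocks.\<close>
    have "(\<Sum>S\<in>Pow V. w S *\<^sub>R ((1 / c) *\<^sub>R f S z))
        = (\<Sum>S\<in>Pow V. \<Sum>j\<in>J. (if card (S \<inter> supp j) = 1 then w S / c else 0) *\<^sub>R ?v j)"
      unfolding f_def using Suc.prems(1)
      by (auto intro!: sum.cong simp: sum.inter_filter scaleR_sum_right)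
    also have "\<dots> = (\<Sum>j\<in>J. (\<Sum>S\<in>Pow V. if card (S \<inter> supp j) = 1 then w S / c else 0) *\<^sub>R ?v j)"
      by (subst sum.swap) (simp add: scaleR_sum_left)
    also have "\<dots> = (\<Sum>j\<in>J. ?v j)"
    proof (rule sum.cong[OF refl])
      fix j assume j: "j \<in> J"
      have "(\<Sum>S\<in>Pow V. if card (S \<inter> supp j) = 1 then w S / c else 0)
          = (\<Sum>S\<in>{S\<in>Pow V. card (S \<inter> supp j) = 1}. w S) / c"
        unfolding sum_divide_distrib sum.inter_filter[OF fP] by (intro sum.cong) auto
      also have "\<dots> = 1"
        using wc[of "supp j"] Suc.prems(3)[OF j] c0 by (auto simp: supp_def)
      finally show "(\<Sum>S\<in>Pow V. if card (S \<inter> supp j) = 1 then w S / c else 0) *\<^sub>R ?v j = ?v j" by simp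
    qed
    finally have "norm (\<Sum>j\<in>J. ?v j) powr p = norm (\<Sum>S\<in>Pow V. w S *\<^sub>R ((1 / c) *\<^sub>R f S z)) powr p" by simp
    also have "\<dots> \<le> (\<Sum>S\<in>Pow V. w S * norm ((1 / c) *\<^sub>R f S z) powr p)"
      using w by (intro norm_sum_powr_le[OF p fP]) auto
    also have "\<dots> \<le> (\<Sum>S\<in>Pow V. w S * (exp p * norm (f S z) powr p))"
    proof (intro sum_mono mult_left_mono w(1)[rule_format])
      fix S
      have "1 / c \<le> exp 1" using c c0 by (simp add: exp_minus field_simps)
      then have "(1 / c) powr p \<le> exp 1 powr p"
        using p0 c0 by (intro powr_mono2) auto
      also have "exp 1 powr p = exp p" by (simp add: powr_def)
      finally have "(1 / c) powr p * norm (f S z) powr p \<le> exp p * norm (f S z) powr p"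
        by (intro mult_right_mono) auto
      then show "norm ((1 / c) *\<^sub>R f S z) powr p \<le> exp p * norm (f S z) powr p"
        using c0 by (simp flip: powr_mult)
    qed
    finally show ?thesis .
  qed
  then have "(\<integral>z. norm (\<Sum>j\<in>J. mon (a j) z *\<^sub>C x j) powr p \<partial>P)
      \<le> (\<integral>z. (\<Sum>S\<in>Pow V. w S * (exp p * norm (f S z) powr p)) \<partial>P)"
    using int_f w(1) by (intro integral_mono' sum_nonneg) auto
  also have "\<dots> = (\<Sum>S\<in>Pow V. w S * (exp p * (\<integral>z. norm (f S z) powr p \<partial>P)))"
    using int_f by (simp add: integral_sum)
  also have "\<dots> \<le> (\<Sum>S\<in>Pow V. w S * B)"
    using w(1) block by (intro sum_mono mult_left_mono) auto
  also have "\<dots> = B" using w(2) by (simp flip: sum_distrib_right)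
  finally show ?case unfolding B_def .
qed

text \<open>The terms are sorted by their number of variables, which is at most the degree since
  every occurring exponent is at least 1. The \<open>m + 1\<close> groups number at most
  \<open>2 ^ m\<close>, so equal weights \<open>1 / 2 ^ m\<close> are admissible, at the price
  \<open>(2 powr p) ^ m\<close>.\<close>

lemma polynomial_bound:
  fixes x :: "'j \<Rightarrow> 'a::complex_banach"
  assumes p: "1 \<le> p" and R: "1 \<le> R"
    and type: "\<And>k y :: 'i \<Rightarrow> 'a. 1 \<le> k \<Longrightarrow>
      (\<integral>w. norm (\<Sum>i\<in>V. \<phi> k (w i) *\<^sub>C y i) powr p \<partial>P) \<le> R * (\<Sum>i\<in>V. norm (y i) powr p)"
    and J: "finite J"
    and inj: "\<And>j j'. j \<in> J \<Longrightarrow> j' \<in> J \<Longrightarrow> (\<forall>i\<in>V. a j i = a j' i) \<Longrightarrow> j = j'"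
    and deg: "\<And>j. j \<in> J \<Longrightarrow> (\<Sum>i\<in>V. a j i) \<le> m"
  shows "(\<integral>w. norm (\<Sum>j\<in>J. mon (a j) w *\<^sub>C x j) powr p \<partial>P)
    \<le> (2 powr p * (2 powr p * (exp p * R))) ^ m * (\<Sum>j\<in>J. norm (x j) powr p)"
proof -
  define D where "D = 2 powr p * (exp p * R)"
  define n where "n j = card {i\<in>V. a j i \<noteq> 0}" for j
  define f where "f s w = (\<Sum>j\<in>{j\<in>J. n j = s}. mon (a j) w *\<^sub>C x j)" for s w
  have p0: "0 \<le> p" using p by simp
  have "1 \<le> exp p * R" using p R by (intro mult_ge1_I) auto
  then have D1: "1 \<le> D"
    unfolding D_def using ge_one_powr_ge_zero[of 2 p] p0 by (intro mult_ge1_I[of "2 powr p"]) auto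
  have n: "n j \<in> {..m}" if "j \<in> J" for j
  proof -
    have "n j = (\<Sum>i\<in>{i\<in>V. a j i \<noteq> 0}. 1)" by (simp add: n_def)
    also have "\<dots> \<le> (\<Sum>i\<in>{i\<in>V. a j i \<noteq> 0}. a j i)" by (rule sum_mono) auto
    also have "\<dots> \<le> (\<Sum>i\<in>V. a j i)" using V by (intro sum_mono2) auto
    finally show ?thesis using deg[OF that] by simp
  qed
  have int_f: "integrable P (\<lambda>w. norm (f s w) powr p)" for s
    unfolding f_def using J p0 by (intro integrable_mon_sum) auto
  have "norm (\<Sum>j\<in>J. mon (a j) w *\<^sub>C x j) powr p \<le> (\<Sum>s\<le>m. (2 powr p) ^ m * norm (f s w) powr p)" for w
  proof -
    have "(\<Sum>j\<in>J. mon (a j) w *\<^sub>C x j) = (\<Sum>s\<le>m. f s w)"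
      unfolding f_def using J n by (intro sum.group[symmetric]) auto
    also have "\<dots> = (\<Sum>s\<le>m. (1 / 2 ^ m) *\<^sub>R (2 ^ m *\<^sub>R f s w))" by simp
    also have "norm \<dots> powr p \<le> (\<Sum>s\<le>m. (1 / 2 ^ m) * norm (2 ^ m *\<^sub>R f s w) powr p)"
    proof (rule norm_sum_powr_le[OF p])
      have "real (Suc m) \<le> 2 ^ m" using less_exp[of m] by (metis Suc_leI of_nat_le_iff of_nat_numeral of_nat_power)
      then show "(\<Sum>s\<le>m. 1 / 2 ^ m :: real) \<le> 1" by simp
    qed auto
    also have "\<dots> \<le> (\<Sum>s\<le>m. 1 * norm (2 ^ m *\<^sub>R f s w) powr p)"
      by (intro sum_mono mult_right_mono) auto
    also have "\<dots> = (\<Sum>s\<le>m. (2 powr p) ^ m * norm (f s w) powr p)"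
      by (simp add: powr_mult power_powr_commute mult.commute)
    finally show ?thesis .
  qed
  then have "(\<integral>w. norm (\<Sum>j\<in>J. mon (a j) w *\<^sub>C x j) powr p \<partial>P)
      \<le> (\<integral>w. (\<Sum>s\<le>m. (2 powr p) ^ m * norm (f s w) powr p) \<partial>P)"
    using int_f by (intro integral_mono' sum_nonneg) auto
  also have "\<dots> = (\<Sum>s\<le>m. (2 powr p) ^ m * (\<integral>w. norm (f s w) powr p \<partial>P))"
    using int_f by (simp add: integral_sum)
  also have "\<dots> \<le> (\<Sum>s\<le>m. (2 powr p) ^ m * (\<Sum>j\<in>{j\<in>J. n j = s}. D ^ (\<Sum>i\<in>V. a j i) * norm (x j) powr p))"
    unfolding f_def using J inj
    by (intro sum_mono mult_left_mono homogeneous_bound[OF p R type D_def]) (auto simp: n_def)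
  also have "\<dots> \<le> (\<Sum>s\<le>m. (2 powr p) ^ m * (\<Sum>j\<in>{j\<in>J. n j = s}. D ^ m * norm (x j) powr p))"
    using D1 deg by (intro sum_mono mult_left_mono mult_right_mono power_increasing) auto
  also have "\<dots> = (2 powr p) ^ m * (D ^ m * (\<Sum>s\<le>m. \<Sum>j\<in>{j\<in>J. n j = s}. norm (x j) powr p))"
    by (simp add: sum_distrib_left)
  also have "(\<Sum>s\<le>m. \<Sum>j\<in>{j\<in>J. n j = s}. norm (x j) powr p) = (\<Sum>j\<in>J. norm (x j) powr p)"
    using J n by (intro sum.group) auto
  finally show ?thesis by (simp add: D_def power_mult_distrib mult_ac)
qed

end

subsection \<open>Torus and sign cube\<close>

lemma measurable_cis: "cis \<in> uniform_measure lborel {0..<2 * pi} \<rightarrow>\<^sub>M restrict_space borel (sphere 0 1)"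
  by (intro measurable_restrict_space2)
     (auto intro!: borel_measurable_continuous_onI continuous_intros
       simp: measurable_cong_sets[OF sets_uniform_measure refl])

lemma sets_circle_measure: "sets circle_measure = sets (restrict_space borel (sphere 0 1))"
  by (simp add: circle_measure_def)

lemma space_circle_measure: "space circle_measure = sphere 0 1"
  by (simp add: circle_measure_def space_restrict_space)

lemma prob_space_circle_measure: "prob_space circle_measure"
  unfolding circle_measure_def
proof (rule prob_space.prob_space_distr[OF _ measurable_cis])
  show "prob_space (uniform_measure lborel {0..<2 * pi})"
    by (rule prob_space_uniform_measure) auto
qed

lemma borel_measurable_power_circle: "(\<lambda>z. z ^ k) \<in> borel_measurable circle_measure"
  unfolding measurable_cong_sets[OF sets_circle_measure refl]
  by (intro measurable_restrict_space1) measurable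

lemma measurable_rotation: "(\<lambda>z. cis t * z) \<in> circle_measure \<rightarrow>\<^sub>M circle_measure"
  unfolding measurable_cong_sets[OF sets_circle_measure sets_circle_measure]
  by (intro measurable_restrict_space3) (auto simp: norm_mult)

lemma emeasure_lborel_shift:
  fixes Y :: "real set"
  assumes "Y \<in> sets borel"
  shows "emeasure lborel ((+) c -` Y) = emeasure lborel Y"
proof -
  have "emeasure lborel Y = emeasure (distr lborel borel ((+) c)) Y" by (simp add: lborel_distr_plus)
  also have "\<dots> = emeasure lborel ((+) c -` Y)" using assms by (subst emeasure_distr) auto
  finally show ?thesis by simp
qed

lemma emeasure_circle_measure:
  assumes "B \<in> sets circle_measure"
  shows "emeasure circle_measure B = emeasure lborel ({0..<2 * pi} \<inter> cis -` B) / ennreal (2 * pi)"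
    and "cis -` B \<in> sets borel"
proof -
  have B: "B \<in> sets (restrict_space borel (sphere 0 1))" using assms by (simp add: sets_circle_measure)
  have "cis -` B \<inter> space (uniform_measure lborel {0..<2 * pi}) \<in> sets (uniform_measure lborel {0..<2 * pi})"
    using measurable_cis B by (rule measurable_sets)
  then show Q: "cis -` B \<in> sets borel" by simp
  show "emeasure circle_measure B = emeasure lborel ({0..<2 * pi} \<inter> cis -` B) / ennreal (2 * pi)"
    unfolding circle_measure_def using Q by (simp add: emeasure_distr[OF measurable_cis B])
qed

text \<open>In the angle variable a rotation is a translation. The part of the shifted interval
  beyond \<open>2 * pi\<close> is carried back to \<open>{0..<t}\<close> by periodicity of
  \<open>cis\<close> and translation invariance of Lebesgue measure.\<close>

lemma distr_rotation:
  assumes t: "0 \<le> t" "t \<le> 2 * pi"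
  shows "distr circle_measure circle_measure (\<lambda>z. cis t * z) = circle_measure"
proof (rule measure_eqI)
  fix B assume "B \<in> sets (distr circle_measure circle_measure (\<lambda>z. cis t * z))"
  then have B: "B \<in> sets circle_measure" by simp
  define Q where "Q = cis -` B"
  have Q[measurable]: "Q \<in> sets borel" unfolding Q_def by (rule emeasure_circle_measure(2)[OF B])
  have per: "2 * pi + \<theta> \<in> Q \<longleftrightarrow> \<theta> \<in> Q" for \<theta>
    by (simp add: Q_def cis_mult[symmetric])
  have B': "(\<lambda>z. cis t * z) -` B \<inter> space circle_measure \<in> sets circle_measure"
    by (rule measurable_sets[OF measurable_rotation B])
  have "{0..<2 * pi} \<inter> cis -` ((\<lambda>z. cis t * z) -` B \<inter> space circle_measure)
      = (+) t -` ({t..<2 * pi + t} \<inter> Q)"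
    by (auto simp: Q_def space_circle_measure cis_mult)
  then have "emeasure lborel ({0..<2 * pi} \<inter> cis -` ((\<lambda>z. cis t * z) -` B \<inter> space circle_measure))
      = emeasure lborel ({t..<2 * pi + t} \<inter> Q)"
    by (simp only:) (rule emeasure_lborel_shift, measurable)
  also have "{t..<2 * pi + t} \<inter> Q = ({t..<2 * pi} \<inter> Q) \<union> ({2 * pi..<2 * pi + t} \<inter> Q)"
    using t by auto
  also have "emeasure lborel \<dots> = emeasure lborel ({t..<2 * pi} \<inter> Q) + emeasure lborel ({2 * pi..<2 * pi + t} \<inter> Q)"
    by (rule plus_emeasure[symmetric]) auto
  also have "emeasure lborel ({2 * pi..<2 * pi + t} \<inter> Q)
      = emeasure lborel ((+) (2 * pi) -` ({2 * pi..<2 * pi + t} \<inter> Q))"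
    by (rule emeasure_lborel_shift[symmetric]) measurable
  also have "(+) (2 * pi) -` ({2 * pi..<2 * pi + t} \<inter> Q) = {0..<t} \<inter> Q"
    by (auto simp: per)
  also have "emeasure lborel ({t..<2 * pi} \<inter> Q) + emeasure lborel ({0..<t} \<inter> Q)
      = emeasure lborel (({t..<2 * pi} \<inter> Q) \<union> ({0..<t} \<inter> Q))"
    by (rule plus_emeasure) auto
  also have "({t..<2 * pi} \<inter> Q) \<union> ({0..<t} \<inter> Q) = {0..<2 * pi} \<inter> Q" using t by auto
  finally show "emeasure (distr circle_measure circle_measure (\<lambda>z. cis t * z)) B = emeasure circle_measure B"
    by (simp add: emeasure_distr[OF measurable_rotation B] emeasure_circle_measure(1)[OF B']
        emeasure_circle_measure(1)[OF B] Q_def)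
qed simp

section \<open>Transfer of type between signs and the circle\<close>

lemma power_rotation:
  assumes "1 \<le> k"
  shows "(cis (pi / real k) * z) ^ k = - (z ^ k)"
  using assms by (simp add: power_mult_distrib Complex.DeMoivre)

text \<open>Rotation by \<open>pi / k\<close> preserves the circle measure and negates
  \<open>z ^ k\<close>, so the same \<open>R\<close> serves for every \<open>k\<close>. The space
  \<open>E\<close> is kept general to cover both finite sign cubes and
  \<open>sign_measure\<close>.\<close>

lemma torus_type_of_sign_type:
  fixes x :: "nat \<Rightarrow> 'a::complex_banach" and E :: "(nat \<Rightarrow> real) measure"
  assumes p: "0 \<le> p" and k: "1 \<le> k" and E: "prob_space E"
    and E_meas: "\<And>i. i < N \<Longrightarrow> (\<lambda>e. e i) \<in> borel_measurable E"
    and E_val: "\<And>i e. i < N \<Longrightarrow> e \<in> space E \<Longrightarrow> e i \<in> {-1, 1}"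
    and R: "0 \<le> R" "\<And>y :: nat \<Rightarrow> 'a. (\<integral>e. norm (\<Sum>i<N. e i *\<^sub>R y i) powr p \<partial>E)
      \<le> R * (\<Sum>i<N. norm (y i) powr p)"
  shows "(\<integral>z. norm (\<Sum>i<N. (z i ^ k) *\<^sub>C x i) powr p \<partial>torus_measure N)
    \<le> R * (\<Sum>i<N. norm (x i) powr p)"
  unfolding torus_measure_def
proof (rule type_of_symmetric[OF p E prob_space_circle_measure, where T = "\<lambda>z. cis (pi / real k) * z"])
  have "pi / real k \<le> pi / 1" using k by (intro divide_left_mono) auto
  then have "pi / real k \<le> 2 * pi" using pi_gt_zero by linarith
  then show "distr circle_measure circle_measure (\<lambda>z. cis (pi / real k) * z) = circle_measure"
    by (intro distr_rotation) auto
qed (use assms in \<open>auto simp: borel_measurable_power_circle measurable_rotation power_rotation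
       space_circle_measure norm_power\<close>)

text \<open>The two constants correspond through \<open>R = C powr p\<close>.\<close>

lemma has_type_iff:
  assumes "0 < p"
  shows "has_type TYPE('a::complex_banach) p \<longleftrightarrow>
    (\<exists>R\<ge>1. \<forall>N. \<forall>x :: nat \<Rightarrow> 'a. (\<integral>z. norm (\<Sum>n<N. z n *\<^sub>C x n) powr p \<partial>torus_measure N)
      \<le> R * (\<Sum>n<N. norm (x n) powr p))" (is "_ \<longleftrightarrow> ?rhs")
proof
  assume "has_type TYPE('a) p"
  then obtain C where C: "1 \<le> C" "\<And>N x. (\<integral>z. norm (\<Sum>n<N. z n *\<^sub>C x n :: 'a) powr p \<partial>torus_measure N) powr (1 / p)
      \<le> C * (\<Sum>n<N. norm (x n) powr p) powr (1 / p)"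
    unfolding has_type_def by blast
  show ?rhs
  proof (intro exI[of _ "C powr p"] conjI allI)
    show "1 \<le> C powr p" using C(1) assms by (simp add: ge_one_powr_ge_zero)
    show "(\<integral>z. norm (\<Sum>n<N. z n *\<^sub>C x n) powr p \<partial>torus_measure N) \<le> C powr p * (\<Sum>n<N. norm (x n) powr p)"
      for N and x :: "nat \<Rightarrow> 'a"
      using C assms by (intro powr_inverse_le_iff[THEN iffD1] C(2) integral_nonneg sum_nonneg) auto
  qed
next
  assume ?rhs
  then obtain R where R: "1 \<le> R" "\<And>N x. (\<integral>z. norm (\<Sum>n<N. z n *\<^sub>C x n :: 'a) powr p \<partial>torus_measure N)
      \<le> R * (\<Sum>n<N. norm (x n) powr p)"
    by blast
  show "has_type TYPE('a) p"
    unfolding has_type_def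
  proof (intro exI[of _ "R powr (1 / p)"] conjI allI)
    show "1 \<le> R powr (1 / p)" using R(1) assms by (simp add: ge_one_powr_ge_zero)
    have "(R powr (1 / p)) powr p = R" using R(1) assms by (simp add: powr_powr)
    then show "(\<integral>z. norm (\<Sum>n<N. z n *\<^sub>C x n) powr p \<partial>torus_measure N) powr (1 / p)
        \<le> R powr (1 / p) * (\<Sum>n<N. norm (x n) powr p) powr (1 / p)" for N and x :: "nat \<Rightarrow> 'a"
      using R assms by (intro powr_inverse_le_iff[THEN iffD2]) (auto intro!: integral_nonneg sum_nonneg)
  qed
qed

lemma measurable_sign_component:
  "i \<in> V \<Longrightarrow> (\<lambda>e. e i) \<in> borel_measurable (pow_measure V sign_space)"
  by (rule measurable_compose[where f = "\<lambda>e. e i" and g = "\<lambda>t. t" and N = sign_space])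
     (auto intro: borel_measurable_sign_space)

lemma sign_component:
  "e \<in> space (pow_measure V sign_space) \<Longrightarrow> i \<in> V \<Longrightarrow> e i \<in> {-1, 1}"
  by (auto simp: space_PiM space_uniform_count_measure)

text \<open>Symmetrization inserts signs into the Steinhaus sum. For each fixed \<open>z\<close>,
  complex contraction removes the unimodular factors at the cost of \<open>2 powr p\<close>, and the
  result is integrated over \<open>z\<close>.\<close>

lemma sign_type_of_has_type:
  assumes p: "1 \<le> p" and "has_type TYPE('a::complex_banach) p"
  obtains R where "1 \<le> R"
    "\<forall>N. \<forall>y :: nat \<Rightarrow> 'a. (\<integral>e. norm (\<Sum>i<N. e i *\<^sub>R y i) powr p \<partial>pow_measure {..<N} sign_space)
      \<le> R * (\<Sum>i<N. norm (y i) powr p)"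
proof -
  have "0 < p" using p by simp
  from has_type_iff[OF this] assms(2) obtain R where R: "1 \<le> R"
    "\<And>N x. (\<integral>z. norm (\<Sum>n<N. z n *\<^sub>C x n :: 'a) powr p \<partial>torus_measure N)
      \<le> R * (\<Sum>n<N. norm (x n) powr p)" by blast
  show thesis
  proof (rule that; (intro allI)?)
    show "1 \<le> 2 powr p * R"
      using R(1) p ge_one_powr_ge_zero[of 2 p] by (intro mult_ge1_I) auto
  next
    fix N and y :: "nat \<Rightarrow> 'a"
    let ?E = "pow_measure {..<N} sign_space" and ?T = "torus_measure N"
    have p0: "0 \<le> p" using p by simp
    have E: "prob_space ?E" by (rule prob_space_pow_measure[OF prob_space_sign_space])
    interpret T: prob_space ?T
      unfolding torus_measure_def by (rule prob_space_pow_measure[OF prob_space_circle_measure])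
    \<comment> \<open>Since \<open>cis pi = -1\<close>, this is the symmetry of the circle under
      negation.\<close>
    have rot: "distr circle_measure circle_measure (\<lambda>z. cis pi * z) = circle_measure"
      by (rule distr_rotation) auto
    have id: "(\<lambda>z. z) \<in> borel_measurable circle_measure"
      using borel_measurable_power_circle[of 1] by simp
    note sym = p0 E prob_space_circle_measure finite_lessThan[of N]
    have eq: "(\<integral>z. norm (\<Sum>i<N. z i *\<^sub>C y i) powr p \<partial>?T)
        = (\<integral>z. (\<integral>e. norm (\<Sum>i<N. e i *\<^sub>R z i *\<^sub>C y i) powr p \<partial>?E) \<partial>?T)"
      unfolding torus_measure_def
      by (rule integral_symmetrization[where s = "\<lambda>i e. e i" and T = "\<lambda>z. cis pi * z", OF sym])
         (use id rot measurable_rotation[of pi] in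
           \<open>auto simp: space_circle_measure intro: measurable_sign_component dest: sign_component\<close>)
    have int: "integrable ?T (\<lambda>z. \<integral>e. norm (\<Sum>i<N. e i *\<^sub>R z i *\<^sub>C y i) powr p \<partial>?E)"
      unfolding torus_measure_def
      by (rule integrable_symmetrization[where s = "\<lambda>i e. e i" and T = "\<lambda>z. cis pi * z", OF sym])
         (use id rot measurable_rotation[of pi] in
           \<open>auto simp: space_circle_measure intro: measurable_sign_component dest: sign_component\<close>)
    have "(\<integral>e. norm (\<Sum>i<N. e i *\<^sub>R y i) powr p \<partial>?E)
        = (\<integral>z. (\<integral>e. norm (\<Sum>i<N. e i *\<^sub>R y i) powr p \<partial>?E) \<partial>?T)"
      by (simp add: T.prob_space)
    also have "\<dots> \<le> (\<integral>z. 2 powr p * (\<integral>e. norm (\<Sum>i<N. e i *\<^sub>R z i *\<^sub>C y i) powr p \<partial>?E) \<partial>?T)"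
    proof (rule integral_mono)
      fix z assume "z \<in> space ?T"
      then have "cmod (z i) = 1" if "i < N" for i
        using that by (auto simp: torus_measure_def space_PiM space_circle_measure PiE_def Pi_def)
      then show "(\<integral>e. norm (\<Sum>i<N. e i *\<^sub>R y i) powr p \<partial>?E)
          \<le> 2 powr p * (\<integral>e. norm (\<Sum>i<N. e i *\<^sub>R z i *\<^sub>C y i) powr p \<partial>?E)"
        by (intro sign_complex_contraction[OF p]) auto
    qed (use int in auto)
    also have "\<dots> = 2 powr p * (\<integral>z. norm (\<Sum>i<N. z i *\<^sub>C y i) powr p \<partial>?T)"
      unfolding eq by simp
    also have "\<dots> \<le> 2 powr p * (R * (\<Sum>i<N. norm (y i) powr p))"
      by (intro mult_left_mono R(2)) auto
    finally show "(\<integral>e. norm (\<Sum>i<N. e i *\<^sub>R y i) powr p \<partial>?E) \<le> 2 powr p * R * (\<Sum>i<N. norm (y i) powr p)"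
      by (simp add: mult_ac)
  qed
qed

section \<open>Type against the polynomial and Walsh inequalities\<close>

lemma finite_multi_indices: "finite (multi_indices n m)"
proof (rule finite_subset)
  show "multi_indices n m \<subseteq> {..<n} \<rightarrow>\<^sub>E {..m}"
  proof
    fix \<alpha> assume \<alpha>: "\<alpha> \<in> multi_indices n m"
    have "\<alpha> i \<le> m" if "i < n" for i
    proof -
      have "\<alpha> i \<le> (\<Sum>i<n. \<alpha> i)" using that by (intro member_le_sum) auto
      then show ?thesis using \<alpha> by (simp add: multi_indices_def)
    qed
    then show "\<alpha> \<in> {..<n} \<rightarrow>\<^sub>E {..m}" using \<alpha> by (auto simp: multi_indices_def PiE_def)
  qed
qed (auto intro: finite_PiE)

text \<open>A constant of the form \<open>K ^ m\<close> keeps its exponential form under the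
  \<open>p\<close>-th root.\<close>

lemma root_le_of_powr_le:
  fixes p :: real
  assumes "0 < p" "0 < K" "0 \<le> I" "0 \<le> B" "I \<le> K ^ m * B"
  shows "I powr (1 / p) \<le> (K powr (1 / p)) ^ m * B powr (1 / p)"
proof (rule powr_inverse_le_iff[THEN iffD2])
  have "((K powr (1 / p)) ^ m) powr p = K ^ m"
    using assms by (simp add: power_powr_commute powr_powr)
  then show "I \<le> ((K powr (1 / p)) ^ m) powr p * B" using assms by simp
qed (use assms in auto)

text \<open>Type is passed to signs and from there to every power \<open>z ^ k\<close> with one
  constant \<open>R\<close>, which is the hypothesis of \<open>polynomial_bound\<close>.\<close>

lemma polynomial_inequality_of_has_type:
  assumes p: "1 \<le> p" and "has_type TYPE('a::complex_banach) p"
  shows "\<exists>C>0. \<forall>m n. \<forall>x :: (nat \<Rightarrow> nat) \<Rightarrow> 'a.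
    (\<integral>z. norm (\<Sum>\<alpha>\<in>multi_indices n m. (\<Prod>i<n. z i ^ \<alpha> i) *\<^sub>C x \<alpha>) powr p \<partial>torus_measure n) powr (1 / p)
      \<le> C ^ m * (\<Sum>\<alpha>\<in>multi_indices n m. norm (x \<alpha>) powr p) powr (1 / p)"
proof -
  obtain R where R: "1 \<le> R" "\<forall>N. \<forall>y :: nat \<Rightarrow> 'a.
      (\<integral>e. norm (\<Sum>i<N. e i *\<^sub>R y i) powr p \<partial>pow_measure {..<N} sign_space)
      \<le> R * (\<Sum>i<N. norm (y i) powr p)"
    by (rule sign_type_of_has_type[OF assms]) (rule that)
  define K where "K = 2 powr p * (2 powr p * (exp p * R))"
  have K: "0 < K" using R(1) by (simp add: K_def)
  have "(\<integral>z. norm (\<Sum>\<alpha>\<in>multi_indices n m. (\<Prod>i<n. z i ^ \<alpha> i) *\<^sub>C x \<alpha>) powr p \<partial>torus_measure n)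
      \<le> K ^ m * (\<Sum>\<alpha>\<in>multi_indices n m. norm (x \<alpha>) powr p)" for m n and x :: "(nat \<Rightarrow> nat) \<Rightarrow> 'a"
  proof -
    interpret S: product_system circle_measure "\<lambda>k z. z ^ k" "{..<n}"
      by (rule product_system.intro)
         (auto simp: borel_measurable_power_circle space_circle_measure norm_power
           prob_space_circle_measure)
    show ?thesis
      unfolding K_def torus_measure_def S.mon_def[symmetric]
    proof (rule S.polynomial_bound[OF p R(1)])
      fix k and y :: "nat \<Rightarrow> 'a" assume k: "1 \<le> (k::nat)"
      show "(\<integral>w. norm (\<Sum>i<n. w i ^ k *\<^sub>C y i) powr p \<partial>S.P) \<le> R * (\<Sum>i<n. norm (y i) powr p)"
        unfolding torus_measure_def[symmetric]
        by (rule torus_type_of_sign_type[OF _ k prob_space_pow_measure[OF prob_space_sign_space, where V = "{..<n}"]])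
           (use p R in \<open>auto intro: measurable_sign_component dest: sign_component\<close>)
    next
      fix \<alpha> \<beta> assume "\<alpha> \<in> multi_indices n m" "\<beta> \<in> multi_indices n m" "\<forall>i\<in>{..<n}. \<alpha> i = \<beta> i"
      then show "\<alpha> = \<beta>" by (intro PiE_ext[of _ "{..<n}" "\<lambda>_. UNIV"]) (auto simp: multi_indices_def)
    next
      show "finite (multi_indices n m)" by (rule finite_multi_indices)
    qed (simp add: multi_indices_def)
  qed
  then show ?thesis
    using p K
    by (intro exI[of _ "K powr (1 / p)"] conjI allI root_le_of_powr_le)
       (auto intro!: integral_nonneg sum_nonneg)
qed

text \<open>A Steinhaus sum is a polynomial of degree at most 1. Besides the unit multi-indices
  \<open>u n\<close>, only the zero index has degree at most 1, and its coefficient is set to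
  0.\<close>

lemma has_type_of_polynomial_inequality:
  assumes p: "1 \<le> p" and C: "0 < C" "\<And>n. \<And>x :: (nat \<Rightarrow> nat) \<Rightarrow> 'a::complex_banach.
    (\<integral>z. norm (\<Sum>\<alpha>\<in>multi_indices n 1. (\<Prod>i<n. z i ^ \<alpha> i) *\<^sub>C x \<alpha>) powr p \<partial>torus_measure n) powr (1 / p)
      \<le> C * (\<Sum>\<alpha>\<in>multi_indices n 1. norm (x \<alpha>) powr p) powr (1 / p)"
  shows "has_type TYPE('a) p"
  unfolding has_type_def
proof (intro exI[of _ "max 1 C"] conjI allI)
  fix N :: nat and x :: "nat \<Rightarrow> 'a"
  define u where "u n = (\<lambda>i\<in>{..<N}. if i = n then 1 else 0 :: nat)" for n
  have inj: "inj_on u {..<N}"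
  proof (rule inj_onI)
    fix n k assume n: "n \<in> {..<N}" and "u n = u k"
    then have "u n n = u k n" by simp
    then show "n = k" using n by (simp add: u_def split: if_splits)
  qed
  have sub: "u ` {..<N} \<subseteq> multi_indices N 1"
  proof
    fix \<alpha> assume "\<alpha> \<in> u ` {..<N}"
    then obtain n where n: "n < N" "\<alpha> = u n" by auto
    have "(\<Sum>i<N. u n i) = (\<Sum>i<N. if i = n then 1 else 0)"
      by (intro sum.cong) (auto simp: u_def)
    then show "\<alpha> \<in> multi_indices N 1"
      unfolding multi_indices_def n(2) by (auto simp: u_def)
  qed
  define x' where "x' \<alpha> = (if \<alpha> \<in> u ` {..<N} then x (inv_into {..<N} u \<alpha>) else 0)" for \<alpha>
  have x': "x' (u n) = x n" if "n < N" for n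
    using that inj by (simp add: x'_def)
  have x'_0: "x' \<alpha> = 0" if "\<alpha> \<notin> u ` {..<N}" for \<alpha>
    using that unfolding x'_def by (rule if_not_P)
  have reduce: "(\<Sum>\<alpha>\<in>multi_indices N 1. g \<alpha>) = (\<Sum>n<N. g (u n))"
    if "\<And>\<alpha>. \<alpha> \<notin> u ` {..<N} \<Longrightarrow> g \<alpha> = 0" for g :: "_ \<Rightarrow> 'b::comm_monoid_add"
  proof -
    have "(\<Sum>\<alpha>\<in>multi_indices N 1. g \<alpha>) = (\<Sum>\<alpha>\<in>u ` {..<N}. g \<alpha>)"
      using sub that finite_multi_indices by (intro sum.mono_neutral_right) auto
    then show ?thesis using inj by (simp add: sum.reindex)
  qed
  have mon: "(\<Prod>i<N. z i ^ u n i) = z n" if "n < N" for n and z :: "nat \<Rightarrow> complex"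
  proof -
    have "(\<Prod>i<N. z i ^ u n i) = (\<Prod>i<N. if i = n then z i else 1)"
      by (intro prod.cong) (auto simp: u_def)
    then show ?thesis using that by simp
  qed
  have "(\<Sum>\<alpha>\<in>multi_indices N 1. (\<Prod>i<N. z i ^ \<alpha> i) *\<^sub>C x' \<alpha>) = (\<Sum>n<N. z n *\<^sub>C x n)" for z
    by (subst reduce) (auto simp: x'_0 scaleC_zero_right x' mon)
  moreover have "(\<Sum>\<alpha>\<in>multi_indices N 1. norm (x' \<alpha>) powr p) = (\<Sum>n<N. norm (x n) powr p)"
    by (subst reduce) (auto simp: x'_0 x')
  ultimately have "(\<integral>z. norm (\<Sum>n<N. z n *\<^sub>C x n) powr p \<partial>torus_measure N) powr (1 / p)
      \<le> C * (\<Sum>n<N. norm (x n) powr p) powr (1 / p)"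
    using C(2)[of N x'] by simp
  also have "\<dots> \<le> max 1 C * (\<Sum>n<N. norm (x n) powr p) powr (1 / p)"
    by (intro mult_right_mono) auto
  finally show "(\<integral>z. norm (\<Sum>n<N. z n *\<^sub>C x n) powr p \<partial>torus_measure N) powr (1 / p)
      \<le> max 1 C * (\<Sum>n<N. norm (x n) powr p) powr (1 / p)" .
qed simp

text \<open>A finite family involves finitely many signs, so the expectation reduces to a finite
  sign cube. There each Walsh function is the monomial whose exponents are the indicator of
  \<open>A\<close>.\<close>

lemma walsh_inequality_of_has_type:
  assumes p: "1 \<le> p" and "has_type TYPE('a::complex_banach) p"
  shows "\<exists>C>0. \<forall>m. \<forall>F :: nat set set. \<forall>x :: nat set \<Rightarrow> 'a.
    finite F \<longrightarrow> (\<forall>A\<in>F. finite A \<and> card A \<le> m) \<longrightarrow>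
    (\<integral>\<epsilon>. norm (\<Sum>A\<in>F. (\<Prod>n\<in>A. \<epsilon> n) *\<^sub>R x A) powr p \<partial>sign_measure) powr (1 / p)
      \<le> C ^ m * (\<Sum>A\<in>F. norm (x A) powr p) powr (1 / p)"
proof -
  obtain R where R: "1 \<le> R" "\<forall>N. \<forall>y :: nat \<Rightarrow> 'a.
      (\<integral>e. norm (\<Sum>i<N. e i *\<^sub>R y i) powr p \<partial>pow_measure {..<N} sign_space)
      \<le> R * (\<Sum>i<N. norm (y i) powr p)"
    by (rule sign_type_of_has_type[OF assms]) (rule that)
  define K where "K = 2 powr p * (2 powr p * (exp p * R))"
  have K: "0 < K" using R(1) by (simp add: K_def)
  have "(\<integral>\<epsilon>. norm (\<Sum>A\<in>F. (\<Prod>n\<in>A. \<epsilon> n) *\<^sub>R x A) powr p \<partial>sign_measure)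
      \<le> K ^ m * (\<Sum>A\<in>F. norm (x A) powr p)"
    if F: "finite F" "\<forall>A\<in>F. finite A \<and> card A \<le> m" for m F and x :: "nat set \<Rightarrow> 'a"
  proof -
    have "finite (\<Union>F)" using F by auto
    then obtain n where n: "\<Union>F \<subseteq> {..<n}" unfolding finite_nat_iff_bounded by blast
    \<comment> \<open>The indicators \<open>a A\<close> use exponents 0 and 1 only. Taking the sign
      itself for every \<open>k\<close> from 1 on makes the type hypothesis the same inequality for
      all these \<open>k\<close>.\<close>
    let ?\<phi> = "\<lambda>k e. if k = 0 then 1 else complex_of_real e"
    interpret S: product_system sign_space ?\<phi> "{..<n}"
      by (rule product_system.intro)
         (auto simp: borel_measurable_sign_space space_uniform_count_measure prob_space_sign_space)
    interpret product_prob_space "\<lambda>_. sign_space" "UNIV :: nat set"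
      by (rule product_prob_space_const[OF prob_space_sign_space])
    define a :: "nat set \<Rightarrow> nat \<Rightarrow> nat" where "a A i = (if i \<in> A then 1 else 0)" for A i
    define G where "G e = norm (\<Sum>A\<in>F. S.mon (a A) e *\<^sub>C x A) powr p" for e
    have mon: "S.mon (a A) e = complex_of_real (\<Prod>n\<in>A. e n)" if "A \<in> F" for A e
    proof -
      have "S.mon (a A) e = (\<Prod>i<n. if i \<in> A then complex_of_real (e i) else 1)"
        unfolding S.mon_def by (intro prod.cong) (auto simp: a_def)
      also have "\<dots> = (\<Prod>i\<in>{..<n} \<inter> A. complex_of_real (e i))"
        by (simp add: prod.inter_restrict)
      also have "{..<n} \<inter> A = A" using n that by auto
      finally show ?thesis by simp
    qed
    have G: "G e = norm (\<Sum>A\<in>F. (\<Prod>n\<in>A. e n) *\<^sub>R x A) powr p" for e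
      by (simp add: G_def mon scaleR_scaleC)
    have r: "(\<lambda>e. restrict e {..<n}) \<in> sign_measure \<rightarrow>\<^sub>M S.P"
      unfolding sign_measure_def by (rule measurable_restrict_subset) auto
    have Gm: "G \<in> borel_measurable S.P"
      unfolding G_def using F(1) by (intro borel_measurable_norm_sum_scaleC S.mon_measurable)
    \<comment> \<open>The finite cube is the marginal of \<open>sign_measure\<close> on the first
      \<open>n\<close> coordinates.\<close>
    have "(\<integral>e. G e \<partial>S.P) = (\<integral>e. G e \<partial>distr sign_measure S.P (\<lambda>e. restrict e {..<n}))"
      unfolding sign_measure_def by (subst distr_PiM_restrict_finite) auto
    also have "\<dots> = (\<integral>e. G (restrict e {..<n}) \<partial>sign_measure)"
      by (rule integral_distr[OF r Gm])
    also have "\<dots> = (\<integral>e. norm (\<Sum>A\<in>F. (\<Prod>n\<in>A. e n) *\<^sub>R x A) powr p \<partial>sign_measure)"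
    proof (rule Bochner_Integration.integral_cong[OF refl])
      fix e :: "nat \<Rightarrow> real"
      have "(\<Prod>i\<in>A. restrict e {..<n} i) = (\<Prod>i\<in>A. e i)" if "A \<in> F" for A
        using n that by (intro prod.cong) auto
      then show "G (restrict e {..<n}) = norm (\<Sum>A\<in>F. (\<Prod>n\<in>A. e n) *\<^sub>R x A) powr p"
        unfolding G by simp
    qed
    finally have "(\<integral>\<epsilon>. norm (\<Sum>A\<in>F. (\<Prod>n\<in>A. \<epsilon> n) *\<^sub>R x A) powr p \<partial>sign_measure) = (\<integral>e. G e \<partial>S.P)" by simp
    also have "\<dots> \<le> K ^ m * (\<Sum>A\<in>F. norm (x A) powr p)"
      unfolding G_def K_def
    proof (rule S.polynomial_bound[OF p R(1) _ F(1)])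
      fix k and y :: "nat \<Rightarrow> 'a" assume "1 \<le> (k::nat)"
      then show "(\<integral>w. norm (\<Sum>i<n. ?\<phi> k (w i) *\<^sub>C y i) powr p \<partial>S.P) \<le> R * (\<Sum>i<n. norm (y i) powr p)"
        using R(2) by (simp flip: scaleR_scaleC)
    next
      fix A B assume "A \<in> F" "B \<in> F" "\<forall>i\<in>{..<n}. a A i = a B i"
      then show "A = B" using n unfolding a_def by (auto split: if_splits)
    next
      fix A assume A: "A \<in> F"
      have "(\<Sum>i<n. a A i) = card ({..<n} \<inter> A)" by (simp add: a_def sum.inter_restrict[symmetric])
      also have "{..<n} \<inter> A = A" using n A by auto
      finally show "(\<Sum>i<n. a A i) \<le> m" using F(2) A by simp
    qed
    finally show ?thesis .
  qed
  then show ?thesis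
    using p K
    by (intro exI[of _ "K powr (1 / p)"] conjI allI impI root_le_of_powr_le)
       (auto intro!: integral_nonneg sum_nonneg)
qed

text \<open>Singletons turn Walsh sums into plain sign sums; the symmetry of the circle under
  negation, exponent \<open>k = 1\<close>, then carries the sign inequality to Steinhaus
  sums.\<close>

lemma has_type_of_walsh_inequality:
  assumes p: "1 \<le> p" and C: "0 < C" "\<And>F. \<And>x :: nat set \<Rightarrow> 'a::complex_banach.
    finite F \<Longrightarrow> (\<forall>A\<in>F. finite A \<and> card A \<le> 1) \<Longrightarrow>
    (\<integral>\<epsilon>. norm (\<Sum>A\<in>F. (\<Prod>n\<in>A. \<epsilon> n) *\<^sub>R x A) powr p \<partial>sign_measure) powr (1 / p)
      \<le> C * (\<Sum>A\<in>F. norm (x A) powr p) powr (1 / p)"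
  shows "has_type TYPE('a) p"
proof -
  have p0: "0 < p" using p by simp
  have sign: "(\<integral>e. norm (\<Sum>i<N. e i *\<^sub>R y i) powr p \<partial>sign_measure)
      \<le> max 1 (C powr p) * (\<Sum>i<N. norm (y i) powr p)" for N and y :: "nat \<Rightarrow> 'a"
  proof -
    have inj: "inj_on (\<lambda>n. {n}) {..<N}" by simp
    have "(\<integral>e. norm (\<Sum>i<N. e i *\<^sub>R y i) powr p \<partial>sign_measure) powr (1 / p)
        \<le> C * (\<Sum>i<N. norm (y i) powr p) powr (1 / p)"
      using C(2)[of "(\<lambda>n. {n}) ` {..<N}" "\<lambda>A. y (the_elem A)"] by (simp add: sum.reindex[OF inj])
    then have "(\<integral>e. norm (\<Sum>i<N. e i *\<^sub>R y i) powr p \<partial>sign_measure) \<le> C powr p * (\<Sum>i<N. norm (y i) powr p)"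
      using p0 C(1) by (subst (asm) powr_inverse_le_iff) (auto intro!: integral_nonneg sum_nonneg)
    also have "\<dots> \<le> max 1 (C powr p) * (\<Sum>i<N. norm (y i) powr p)"
      by (intro mult_right_mono sum_nonneg) auto
    finally show ?thesis .
  qed
  have "(\<integral>z. norm (\<Sum>n<N. z n *\<^sub>C x n) powr p \<partial>torus_measure N)
      \<le> max 1 (C powr p) * (\<Sum>n<N. norm (x n) powr p)" for N and x :: "nat \<Rightarrow> 'a"
  proof -
    have "(\<integral>z. norm (\<Sum>n<N. (z n ^ 1) *\<^sub>C x n) powr p \<partial>torus_measure N)
      \<le> max 1 (C powr p) * (\<Sum>n<N. norm (x n) powr p)"
    proof (rule torus_type_of_sign_type[OF _ _ _ _ _ _ sign])
      show "prob_space sign_measure"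
        unfolding sign_measure_def by (rule prob_space_pow_measure[OF prob_space_sign_space])
    qed (use p0 in \<open>auto simp: sign_measure_def intro: measurable_sign_component dest: sign_component\<close>)
    then show ?thesis by simp
  qed
  then show ?thesis
    unfolding has_type_iff[OF p0] by (intro exI[of _ "max 1 (C powr p)"]) auto
qed

theorem theorem3p2:
  fixes p :: real
  assumes "1 \<le> p" and "p \<le> 2"
  shows
    "(has_type TYPE('a::complex_banach) p \<longleftrightarrow>
       (\<exists>C>0. \<forall>m n. \<forall>x :: (nat \<Rightarrow> nat) \<Rightarrow> 'a.
          (\<integral>z. norm (\<Sum>\<alpha>\<in>multi_indices n m. (\<Prod>i<n. z i ^ \<alpha> i) *\<^sub>C x \<alpha>) powr p
             \<partial>torus_measure n) powr (1 / p)
            \<le> C ^ m * (\<Sum>\<alpha>\<in>multi_indices n m. norm (x \<alpha>) powr p) powr (1 / p)))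
     \<and>
     (has_type TYPE('a) p \<longleftrightarrow>
       (\<exists>C>0. \<forall>m. \<forall>F :: nat set set. \<forall>x :: nat set \<Rightarrow> 'a.
          finite F \<longrightarrow> (\<forall>A\<in>F. finite A \<and> card A \<le> m) \<longrightarrow>
          (\<integral>\<epsilon>. norm (\<Sum>A\<in>F. (\<Prod>n\<in>A. \<epsilon> n) *\<^sub>R x A) powr p
             \<partial>sign_measure) powr (1 / p)
            \<le> C ^ m * (\<Sum>A\<in>F. norm (x A) powr p) powr (1 / p)))"
    (is "(?type \<longleftrightarrow> (\<exists>C>0. ?b C)) \<and> (?type \<longleftrightarrow> (\<exists>C>0. ?c C))")
proof (intro conjI iffI)
  show "\<exists>C>0. ?b C" if ?type
    using that by (rule polynomial_inequality_of_has_type[OF assms(1)])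
  show "\<exists>C>0. ?c C" if ?type
    using that by (rule walsh_inequality_of_has_type[OF assms(1)])
  show ?type if "\<exists>C>0. ?b C"
  proof -
    \<comment> \<open>The inequality is instantiated at \<open>m = 1\<close>, where
      \<open>C ^ m\<close> is \<open>C\<close>.\<close>
    from that obtain C where C: "0 < C" "?b C" by blast
    show ?thesis
      by (rule has_type_of_polynomial_inequality[OF assms(1) C(1)])
         (use spec[OF C(2), of 1] in simp)
  qed
  show ?type if "\<exists>C>0. ?c C"
  proof -
    from that obtain C where C: "0 < C" "?c C" by blast
    show ?thesis
      by (rule has_type_of_walsh_inequality[OF assms(1) C(1)])
         (use spec[OF C(2), of 1] in simp)
  qed
qed

end
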